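(* Let $f=g+h$ where $g\colon\mathbb{R}^d\to\mathbb{R}$ is $L$-smooth and $\mu$-strongly convex and $h\colon\mathbb{R}^d\to\mathbb{R}\cup\{+\infty\}$ is closed and convex. Let $\bar x$ be the minimizer of $f$, $f^*=\min f$, $\kappa=L/\mu$, and $$D_h(x,\bar x):=h(x)-h(\bar x)+\langle\nabla g(\bar x),x-\bar x\rangle .$$ Let $G$ be a stochastic gradient oracle for $g$ with variance bound $\sigma^2$ and $\mathcal{M}_f$ a minimization oracle for $f$, as in the context. Let $m\in\mathbb{N}$ and $\epsilon>0$. Then with probability at least $1-2\exp\left(-\frac{m}{18}\right)$, the point $x=\mathtt{RobustGap}(\mathcal{M}_f(\cdot),m,\epsilon)$ (defined in the context) satisfies $$\|x-\bar x\|\le3\sqrt{\frac{2\epsilon}{\mu}},\qquad D_h(x,\bar x)\le65\kappa\epsilon,\qquad f(x)-f^*\le74\kappa\epsilon .$$ In total, the procedure queries $m$ times the oracle $\mathcal{M}_f(\epsilon)$ and evaluates $m\cdot\left\lceil\frac{3\sigma^2}{\kappa^2\mu\epsilon}\right\rceil$ times the stochastic gradient oracle $G(\hat x,\cdot)$.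
   Context: $\mu$-strongly convex means $g-\frac\mu2\|\cdot\|^2$ is convex; $L$-smooth means differentiable with $L$-Lipschitz gradient. Stochastic gradient oracle: $(\Omega,\mathcal{F},\mathcal{P})$ is a probability space and $G\colon\mathbb{R}^d\times\Omega\to\mathbb{R}^d$ is measurable with $\mathbb{E}_zG(x,z)=\nabla g(x)$ and $\mathbb{E}_z\|G(x,z)-\nabla g(x)\|^2\le\sigma^2$; for any $x$ one may sample $z\sim\mathcal{P}$ and compute $G(x,z)$. Minimization oracle: $\mathcal{M}_f(\epsilon)$ is a randomized procedure returning a point $x_\epsilon$ with $\mathbb{P}(f(x_\epsilon)-f^*\le\epsilon)\ge\frac23$. Different calls are statistically independent. $\mathtt{Extract}(\{y_i\}_{i=1}^m,\rho)$, for points $y_1,\dots,y_m$ in a set with pseudometric $\rho$ (nonnegative, symmetric, zero on the diagonal, triangle inequality): for each $i$ let $r_i$ be the smallest $r\ge0$ such that more than $m/2$ of the points $y_k$ satisfy $\rho(y_i,y_k)\le r$; let $\hat r$ be the median of $r_1,\dots,r_m$, meaning the $\lceil m/2\rceil$-th entry in the list sorted in increasing order; return the index set $\{i:r_i\le\hat r\}$. Robust gradient estimator $\mathcal{G}_\sigma(\hat x,\varepsilon,m)$: independently for $k=1,\dots,m$, let $v_k=\frac1s\sum_{i=1}^sG(\hat x,z_i)$ with $s=\lceil3\sigma^2/\varepsilon^2\rceil$ fresh i.i.d. samples $z_i\sim\mathcal{P}$; for each $k$ let $r_k$ be the smallest $r\ge0$ such that more than $m/2$ of the points $v_l$ satisfy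 $\|v_k-v_l\|\le r$; return $v_{k^*}$ where $k^*$ minimizes $r_k$. $\mathtt{RobustGap}(\mathcal{M}_f(\cdot),m,\epsilon)$: (1) independently generate $x_1,\dots,x_m$ by $m$ calls to $\mathcal{M}_f(\epsilon)$. (2) $\mathcal{I}_1=\mathtt{Extract}(\{x_i\}_{i=1}^m,\rho_1)$ with $\rho_1(x,x')=\|x-x'\|$. (3) Fix an arbitrary $i\in\mathcal{I}_1$, set $\hat x=x_i$ and $\widetilde\nabla g(\hat x)=\mathcal{G}_\sigma(\hat x,\kappa\sqrt{\mu\epsilon},m)$. (4) $\mathcal{I}_2=\mathtt{Extract}(\{x_i\}_{i=1}^m,\rho_2)$ with the pseudometric $\rho_2(x,x')=|h(x)-h(x')+\langle\widetilde\nabla g(\hat x),x-x'\rangle|$ on $\operatorname{dom}h$. Return $x_i$ for an arbitrary $i\in\mathcal{I}_1\cap\mathcal{I}_2$.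
   Formalization: For even m the set I_1∩I_2 can be empty, so the bounds are claimed only for a point that is actually returned; for odd m a point is always returned. Also σ>0 is assumed, since s=0 for σ=0, and ρ_2 is set to +∞ outside dom h. *)

theory Defs
  imports "HOL-Probability.Probability"
begin

section \<open>Function classes\<close>

definition gradient :: "('a::euclidean_space \<Rightarrow> real) \<Rightarrow> 'a \<Rightarrow> 'a" where
  "gradient g x = (THE D. GDERIV g x :> D)"

definition smooth_fun :: "real \<Rightarrow> ('a::euclidean_space \<Rightarrow> real) \<Rightarrow> bool" where
  "smooth_fun L g \<longleftrightarrow> (\<forall>x. \<exists>D. GDERIV g x :> D) \<and> L-lipschitz_on UNIV (gradient g)"

definition strongly_convex :: "real \<Rightarrow> ('a::euclidean_space \<Rightarrow> real) \<Rightarrow> bool" where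
  "strongly_convex \<mu> g \<longleftrightarrow> convex_on UNIV (\<lambda>x. g x - \<mu> / 2 * (norm x)\<^sup>2)"

definition ereal_epigraph :: "('a \<Rightarrow> ereal) \<Rightarrow> ('a \<times> real) set" where
  "ereal_epigraph h = {(x, t). h x \<le> ereal t}"

text \<open>Values in the reals together with plus infinity, finite somewhere.\<close>

definition closed_convex_fun :: "('a::euclidean_space \<Rightarrow> ereal) \<Rightarrow> bool" where
  "closed_convex_fun h \<longleftrightarrow>
     (\<forall>x. h x \<noteq> -\<infinity>) \<and> (\<exists>x. h x \<noteq> \<infinity>) \<and>
     closed (ereal_epigraph h) \<and> convex (ereal_epigraph h)"

definition D_h :: "('a::euclidean_space \<Rightarrow> real) \<Rightarrow> ('a \<Rightarrow> ereal) \<Rightarrow> 'a \<Rightarrow> 'a \<Rightarrow> ereal" where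
  "D_h g h x y = h x - h y + ereal (gradient g y \<bullet> (x - y))"


section \<open>Oracles\<close>

definition stochastic_gradient_oracle ::
  "('a::euclidean_space \<Rightarrow> real) \<Rightarrow> real \<Rightarrow> 'z measure \<Rightarrow> ('a \<Rightarrow> 'z \<Rightarrow> 'a) \<Rightarrow> bool" where
  "stochastic_gradient_oracle g \<sigma> P G \<longleftrightarrow>
     prob_space P \<and>
     (\<lambda>(x, z). G x z) \<in> borel_measurable (borel \<Otimes>\<^sub>M P) \<and>
     (\<forall>x. integrable P (G x) \<and> (\<integral>z. G x z \<partial>P) = gradient g x \<and>
          integrable P (\<lambda>z. (norm (G x z - gradient g x))\<^sup>2) \<and>
          (\<integral>z. (norm (G x z - gradient g x))\<^sup>2 \<partial>P) \<le> \<sigma>\<^sup>2)"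

text \<open>
  A randomized procedure is a measurable function of a random seed drawn from \<open>U\<close>:
  \<open>A \<epsilon> u\<close> is the point returned for accuracy \<open>\<epsilon>\<close> on the seed \<open>u\<close>.
\<close>

definition minimization_oracle ::
  "('a::euclidean_space \<Rightarrow> ereal) \<Rightarrow> 'u measure \<Rightarrow> (real \<Rightarrow> 'u \<Rightarrow> 'a) \<Rightarrow> bool" where
  "minimization_oracle f U A \<longleftrightarrow>
     prob_space U \<and>
     (\<forall>\<epsilon>>0. A \<epsilon> \<in> U \<rightarrow>\<^sub>M borel \<and>
        measure U {u \<in> space U. f (A \<epsilon> u) - (INF y. f y) \<le> ereal \<epsilon>} \<ge> 2 / 3)"


section \<open>Procedures with oracle access\<close>

text \<open>
  A procedure can reach the two oracles only through query nodes; the continuation of a node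
  receives the answer.
\<close>

datatype ('a, 'r) proc =
    Return 'r
  | Query_Min real "'a \<Rightarrow> ('a, 'r) proc"
  | Query_Grad 'a "'a \<Rightarrow> ('a, 'r) proc"

primrec and_then :: "('a, 'r) proc \<Rightarrow> ('r \<Rightarrow> ('a, 's) proc) \<Rightarrow> ('a, 's) proc" where
  "and_then (Return r) k = k r"
| "and_then (Query_Min \<epsilon> c) k = Query_Min \<epsilon> (\<lambda>y. and_then (c y) k)"
| "and_then (Query_Grad x c) k = Query_Grad x (\<lambda>y. and_then (c y) k)"

primrec repeat_proc :: "nat \<Rightarrow> ('a, 'r) proc \<Rightarrow> ('a, 'r list) proc" where
  "repeat_proc 0 p = Return []"
| "repeat_proc (Suc n) p =
     and_then p (\<lambda>r. and_then (repeat_proc n p) (\<lambda>rs. Return (r # rs)))"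

text \<open>
  Execution with oracles \<open>A\<close> and \<open>G\<close>. Every query consumes the next entry of the tape of random
  inputs of its oracle. Returned are the result, the arguments of the queries to \<open>A\<close>, and the
  arguments of the queries to \<open>G\<close>.
\<close>

primrec run ::
  "(real \<Rightarrow> 'u \<Rightarrow> 'a) \<Rightarrow> ('a \<Rightarrow> 'z \<Rightarrow> 'a) \<Rightarrow> ('a, 'r) proc \<Rightarrow>
   (nat \<Rightarrow> 'u) \<Rightarrow> (nat \<Rightarrow> 'z) \<Rightarrow> 'r \<times> real list \<times> 'a list" where
  "run A G (Return r) = (\<lambda>us zs. (r, [], []))"
| "run A G (Query_Min \<epsilon> c) = (\<lambda>us zs.
     let (r, as, gs) = run A G (c (A \<epsilon> (us 0))) (\<lambda>n. us (Suc n)) zs in (r, \<epsilon> # as, gs))"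
| "run A G (Query_Grad x c) = (\<lambda>us zs.
     let (r, as, gs) = run A G (c (G x (zs 0))) us (\<lambda>n. zs (Suc n)) in (r, as, x # gs))"

definition result_of :: "'r \<times> real list \<times> 'a list \<Rightarrow> 'r" where
  "result_of t = fst t"

definition min_queries :: "'r \<times> real list \<times> 'a list \<Rightarrow> real list" where
  "min_queries t = fst (snd t)"

definition grad_queries :: "'r \<times> real list \<times> 'a list \<Rightarrow> 'a list" where
  "grad_queries t = snd (snd t)"

text \<open>All tape entries are mutually independent.\<close>

definition tapes :: "'u measure \<Rightarrow> 'z measure \<Rightarrow> ((nat \<Rightarrow> 'u) \<times> (nat \<Rightarrow> 'z)) measure" where
  "tapes U P = (\<Pi>\<^sub>M n\<in>UNIV. U) \<Otimes>\<^sub>M (\<Pi>\<^sub>M n\<in>UNIV. P)"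


section \<open>The procedures\<close>

text \<open>
  Points are indexed by \<open>0, \<dots>, m - 1\<close>. Distances are extended reals because the pseudometric
  \<open>rho2\<close> below is finite only on the domain of \<open>h\<close>.
\<close>

definition radius :: "nat \<Rightarrow> ('p \<Rightarrow> 'p \<Rightarrow> ereal) \<Rightarrow> (nat \<Rightarrow> 'p) \<Rightarrow> nat \<Rightarrow> ereal" where
  "radius m \<rho> y i = (LEAST r. 0 \<le> r \<and> real (card {k. k < m \<and> \<rho> (y i) (y k) \<le> r}) > real m / 2)"

definition median_radius :: "nat \<Rightarrow> ('p \<Rightarrow> 'p \<Rightarrow> ereal) \<Rightarrow> (nat \<Rightarrow> 'p) \<Rightarrow> ereal" where
  "median_radius m \<rho> y = sort (map (radius m \<rho> y) [0..<m]) ! (nat \<lceil>real m / 2\<rceil> - 1)"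

definition extract_indices :: "nat \<Rightarrow> ('p \<Rightarrow> 'p \<Rightarrow> ereal) \<Rightarrow> (nat \<Rightarrow> 'p) \<Rightarrow> nat set" where
  "extract_indices m \<rho> y = {i. i < m \<and> radius m \<rho> y i \<le> median_radius m \<rho> y}"

definition rho1 :: "'a::euclidean_space \<Rightarrow> 'a \<Rightarrow> ereal" where
  "rho1 x x' = ereal (norm (x - x'))"

text \<open>In extended real arithmetic the value is infinite if \<open>x\<close> or \<open>x'\<close> lies outside the domain of \<open>h\<close>.\<close>

definition rho2 :: "('a::euclidean_space \<Rightarrow> ereal) \<Rightarrow> 'a \<Rightarrow> 'a \<Rightarrow> 'a \<Rightarrow> ereal" where
  "rho2 h w x x' = \<bar>h x - h x' + ereal (w \<bullet> (x - x'))\<bar>"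

definition vec_of_list :: "nat \<Rightarrow> 'p list \<Rightarrow> nat \<Rightarrow> 'p" where
  "vec_of_list m ys = (\<lambda>i\<in>{..<m}. ys ! i)"

definition average :: "'a::euclidean_space list \<Rightarrow> 'a" where
  "average ys = (1 / real (length ys)) *\<^sub>R sum_list ys"

definition minimal_radius :: "nat \<Rightarrow> (nat \<Rightarrow> 'a::euclidean_space) \<Rightarrow> nat set" where
  "minimal_radius m v = {k. is_arg_min (radius m rho1 v) (\<lambda>k. k < m) k}"

text \<open>
  The arbitrary choices of the procedures are parameters: \<open>tie\<close> selects the index of minimal
  radius, \<open>sel1\<close> an index of the first extracted set, and \<open>sel2\<close> an index of the intersection.
  Each may depend on everything its procedure has computed so far.
\<close>

definition robust_gradient ::
  "('a::euclidean_space \<Rightarrow> (nat \<Rightarrow> 'a) \<Rightarrow> nat) \<Rightarrow> real \<Rightarrow> 'a \<Rightarrow> real \<Rightarrow> nat \<Rightarrow> ('a, 'a) proc" where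
  "robust_gradient tie \<sigma> xhat e m =
     and_then
       (repeat_proc m
         (and_then (repeat_proc (nat \<lceil>3 * \<sigma>\<^sup>2 / e\<^sup>2\<rceil>) (Query_Grad xhat Return))
           (\<lambda>gs. Return (average gs))))
       (\<lambda>vs. let v = vec_of_list m vs in Return (v (tie xhat v)))"

text \<open>
  For even \<open>m\<close> the two extracted sets can be disjoint; the procedure then has no point to return,
  and the result is \<open>None\<close>.
\<close>

definition robust_gap ::
  "((nat \<Rightarrow> 'a::euclidean_space) \<Rightarrow> nat) \<Rightarrow> ('a \<Rightarrow> (nat \<Rightarrow> 'a) \<Rightarrow> nat) \<Rightarrow>
   ((nat \<Rightarrow> 'a) \<Rightarrow> 'a \<Rightarrow> nat) \<Rightarrow> ('a \<Rightarrow> ereal) \<Rightarrow> real \<Rightarrow> real \<Rightarrow> real \<Rightarrow> nat \<Rightarrow> real \<Rightarrow>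
   ('a, 'a option) proc" where
  "robust_gap sel1 tie sel2 h \<kappa> \<mu> \<sigma> m \<epsilon> =
     and_then (repeat_proc m (Query_Min \<epsilon> Return)) (\<lambda>xs.
       let x = vec_of_list m xs; I1 = extract_indices m rho1 x; xhat = x (sel1 x) in
       and_then (robust_gradient tie \<sigma> xhat (\<kappa> * sqrt (\<mu> * \<epsilon>)) m) (\<lambda>w.
         let I2 = extract_indices m (rho2 h w) x in
         Return (if I1 \<inter> I2 = {} then None else Some (x (sel2 x w)))))"

definition selects_from :: "'s measure \<Rightarrow> ('s \<Rightarrow> nat set) \<Rightarrow> ('s \<Rightarrow> nat) \<Rightarrow> bool" where
  "selects_from S I c \<longleftrightarrow>
     c \<in> S \<rightarrow>\<^sub>M count_space UNIV \<and> (\<forall>s\<in>space S. I s \<noteq> {} \<longrightarrow> c s \<in> I s)"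

abbreviation points :: "nat \<Rightarrow> (nat \<Rightarrow> 'a::euclidean_space) measure" where
  "points m \<equiv> (\<Pi>\<^sub>M i\<in>{..<m}. borel)"

definition selection_rules ::
  "('a::euclidean_space \<Rightarrow> ereal) \<Rightarrow> nat \<Rightarrow> ((nat \<Rightarrow> 'a) \<Rightarrow> nat) \<Rightarrow>
   ('a \<Rightarrow> (nat \<Rightarrow> 'a) \<Rightarrow> nat) \<Rightarrow> ((nat \<Rightarrow> 'a) \<Rightarrow> 'a \<Rightarrow> nat) \<Rightarrow> bool" where
  "selection_rules h m sel1 tie sel2 \<longleftrightarrow>
     selects_from (points m) (extract_indices m rho1) sel1 \<and>
     selects_from (borel \<Otimes>\<^sub>M points m) (\<lambda>(xhat, v). minimal_radius m v) (\<lambda>(xhat, v). tie xhat v) \<and>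
     selects_from (points m \<Otimes>\<^sub>M borel) (\<lambda>(x, w). extract_indices m rho1 x \<inter> extract_indices m (rho2 h w) x)
       (\<lambda>(x, w). sel2 x w)"

end

theory Submission
  imports Defs
begin

text \<open>
  A single call of either oracle fails with probability at most \<open>1/3\<close> (for a batch of gradients by
  Chebyshev's inequality), so by Hoeffding's inequality a strict majority of \<open>m\<close> independent calls
  succeeds with probability at least \<open>1 - exp (- m / 18)\<close>. If a strict majority of points lies within
  distance \<open>r\<close> of each other, then the radius of an extracted point is at most \<open>r\<close>, and the ball of
  that radius contains more than half of the points, hence one from the majority. With
  \<open>\<delta> = sqrt (2 * \<epsilon> / \<mu>)\<close> this puts \<open>xhat\<close> and the returned point within \<open>3 * \<delta>\<close> of \<open>xbar\<close> and the
  estimated gradient within \<open>3 * \<kappa> * sqrt (\<mu> * \<epsilon>)\<close> of the gradient at \<open>xhat\<close>. On the majority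
  \<open>D_h\<close> takes values between \<open>0\<close> and \<open>\<epsilon>\<close>, and \<open>rho2\<close> differs from the difference of two values of
  \<open>D_h\<close> only by the error of the gradient, so the second extraction bounds \<open>D_h\<close> at the returned
  point. Smoothness of \<open>g\<close> turns the first two bounds into the bound on \<open>f\<close>.

  The gradient samples are independent of \<open>xhat\<close>, so the estimator is analysed with \<open>xhat\<close> fixed and
  the result is integrated over the seeds of the minimization oracle.
\<close>

section \<open>Extraction by medians\<close>

lemma radius_least:
  fixes \<rho> :: "'p \<Rightarrow> 'p \<Rightarrow> ereal" and y :: "nat \<Rightarrow> 'p" and i :: nat
  assumes "0 < m"
  defines "S \<equiv> {r. 0 \<le> r \<and> real (card {k. k < m \<and> \<rho> (y i) (y k) \<le> r}) > real m / 2}"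
  shows "radius m \<rho> y i \<in> S" and "r \<in> S \<Longrightarrow> radius m \<rho> y i \<le> r"
proof -
  let ?N = "\<lambda>r. {k. k < m \<and> \<rho> (y i) (y k) \<le> r}"
  define C where "C = insert 0 ((\<lambda>k. \<rho> (y i) (y k)) ` {..<m})"
  have fin: "finite C"
    by (simp add: C_def)
  have cand: "\<exists>c\<in>C \<inter> S. c \<le> r" if r: "r \<in> S" for r
  proof -
    let ?c = "Max {c \<in> C. c \<le> r}"
    have "0 \<in> {c \<in> C. c \<le> r}"
      using r by (simp add: C_def S_def)
    then have c: "?c \<in> {c \<in> C. c \<le> r}" and "0 \<le> ?c"
      using fin by (intro Max_in Max_ge; auto)+
    moreover have "?N ?c = ?N r"
    proof -
      have "\<rho> (y i) (y k) \<le> ?c" if "k < m" "\<rho> (y i) (y k) \<le> r" for k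
        using that fin by (intro Max_ge) (auto simp: C_def)
      then show ?thesis
        using c by (auto intro: order_trans)
    qed
    ultimately have "?c \<in> S"
      using r by (simp add: S_def)
    then show ?thesis
      using c by blast
  qed
  have "\<infinity> \<in> S"
    using \<open>0 < m\<close> by (simp add: S_def)
  then have ne: "C \<inter> S \<noteq> {}"
    using cand by blast
  have min: "Min (C \<inter> S) \<in> S" "\<And>r. r \<in> S \<Longrightarrow> Min (C \<inter> S) \<le> r"
  proof -
    show "Min (C \<inter> S) \<in> S"
      using Min_in[of "C \<inter> S"] fin ne by blast
    show "Min (C \<inter> S) \<le> r" if "r \<in> S" for r
      using cand[OF that] fin by (meson Min_le finite_Int order_trans)
  qed
  have "radius m \<rho> y i = Min (C \<inter> S)"
    unfolding radius_def
    by (rule Least_equality) (use min in \<open>auto simp: S_def\<close>)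
  then show "radius m \<rho> y i \<in> S" and "r \<in> S \<Longrightarrow> radius m \<rho> y i \<le> r"
    using min by auto
qed

lemma radius_le_iff:
  assumes "0 < m"
  shows "radius m \<rho> y i \<le> r \<longleftrightarrow> 0 \<le> r \<and> m < 2 * card {k. k < m \<and> \<rho> (y i) (y k) \<le> r}"
proof
  assume le: "radius m \<rho> y i \<le> r"
  have "card {k. k < m \<and> \<rho> (y i) (y k) \<le> radius m \<rho> y i} \<le> card {k. k < m \<and> \<rho> (y i) (y k) \<le> r}"
    using le by (intro card_mono) (auto intro: order_trans)
  then show "0 \<le> r \<and> m < 2 * card {k. k < m \<and> \<rho> (y i) (y k) \<le> r}"
    using radius_least(1)[OF assms, of \<rho> y i] le by auto
next
  assume "0 \<le> r \<and> m < 2 * card {k. k < m \<and> \<rho> (y i) (y k) \<le> r}"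
  then show "radius m \<rho> y i \<le> r"
    using radius_least(2)[OF assms, of r \<rho> y i] by auto
qed

lemma sorted_nth_le_iff:
  assumes "sorted xs" "k < length xs"
  shows "xs ! k \<le> r \<longleftrightarrow> k < length (filter (\<lambda>x. x \<le> r) xs)"
  using assms
proof (induction xs arbitrary: k)
  case (Cons x xs)
  show ?case
  proof (cases "x \<le> r")
    case True
    then show ?thesis
      using Cons by (cases k) auto
  next
    case False
    then have "filter (\<lambda>x. x \<le> r) xs = []"
      using Cons.prems by (auto simp: filter_empty_conv intro: order_trans)
    moreover have "\<not> (x # xs) ! k \<le> r"
      using False Cons.prems sorted_nth_mono[of "x # xs" 0 k] by (auto intro: order_trans)
    ultimately show ?thesis
      using False by simp
  qed
qed simp

lemma median_radius_le_iff:
  assumes "0 < m"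
  shows "median_radius m \<rho> y \<le> r \<longleftrightarrow> m \<le> 2 * card {i. i < m \<and> radius m \<rho> y i \<le> r}"
proof -
  let ?k = "nat \<lceil>real m / 2\<rceil> - 1"
  have k: "?k = (m - 1) div 2"
  proof -
    have "\<lceil>real m / 2\<rceil> = int ((m + 1) div 2)"
    proof (cases "even m")
      case True
      then show ?thesis
        by (auto elim!: evenE)
    next
      case False
      then obtain q where "m = 2 * q + 1"
        by (rule oddE)
      then show ?thesis
        by (simp add: ceiling_eq_iff)
    qed
    then show ?thesis
      using assms by simp
  qed
  have "length (filter (\<lambda>x. x \<le> r) (sort (map (radius m \<rho> y) [0..<m])))
      = length (filter (\<lambda>x. x \<le> r) (map (radius m \<rho> y) [0..<m]))"
    by (metis mset_filter mset_sort size_mset)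
  also have "\<dots> = card {i. i < m \<and> radius m \<rho> y i \<le> r}"
    unfolding length_filter_conv_card by (intro arg_cong[where f=card]) auto
  finally show ?thesis
    unfolding median_radius_def k
    using assms by (subst sorted_nth_le_iff) auto
qed

lemma majorities_meet:
  fixes S T :: "nat set"
  assumes "S \<subseteq> {..<m}" "T \<subseteq> {..<m}" "m < card S + card T"
  shows "S \<inter> T \<noteq> {}"
proof
  assume "S \<inter> T = {}"
  then have "card S + card T = card (S \<union> T)"
    using assms by (auto simp: card_Un_disjoint finite_subset)
  also have "\<dots> \<le> card {..<m}"
    using assms by (intro card_mono) auto
  finally show False
    using assms by simp
qed

lemma extract_near_majority:
  assumes i: "i \<in> extract_indices m \<rho> y"
    and S: "S \<subseteq> {..<m}" "m < 2 * card S"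
    and "\<And>j k. j \<in> S \<Longrightarrow> k \<in> S \<Longrightarrow> \<rho> (y j) (y k) \<le> r" and "0 \<le> r"
  shows "\<exists>k\<in>S. \<rho> (y i) (y k) \<le> r"
proof -
  have m: "0 < m"
    using i by (auto simp: extract_indices_def)
  have "radius m \<rho> y j \<le> r" if "j \<in> S" for j
  proof -
    have "card S \<le> card {k. k < m \<and> \<rho> (y j) (y k) \<le> r}"
      using S assms that by (intro card_mono) auto
    then show ?thesis
      using S assms by (simp add: radius_le_iff[OF m])
  qed
  then have "card S \<le> card {j. j < m \<and> radius m \<rho> y j \<le> r}"
    using S by (intro card_mono) auto
  then have "median_radius m \<rho> y \<le> r"
    using S by (simp add: median_radius_le_iff[OF m])
  then have "radius m \<rho> y i \<le> r"
    using i by (auto simp: extract_indices_def intro: order_trans)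
  then have N: "m < 2 * card {k. k < m \<and> \<rho> (y i) (y k) \<le> r}" (is "_ < 2 * card ?N")
    by (simp add: radius_le_iff[OF m])
  have "S \<inter> ?N \<noteq> {}"
    using S N by (intro majorities_meet) auto
  then show ?thesis
    by blast
qed

lemma card_extract:
  assumes "0 < m"
  shows "m \<le> 2 * card (extract_indices m \<rho> y)"
  using median_radius_le_iff[OF assms, of \<rho> y "median_radius m \<rho> y"]
  by (simp add: extract_indices_def)

lemma extract_nonempty:
  assumes "0 < m"
  shows "extract_indices m \<rho> y \<noteq> {}"
  using card_extract[OF assms, of \<rho> y] assms by auto

lemma extract_Int_nonempty:
  assumes "odd m"
  shows "extract_indices m \<rho> y \<inter> extract_indices m \<rho>' y' \<noteq> {}"
proof (rule majorities_meet)
  have ge: "m < 2 * card (extract_indices m \<rho> y)"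
    using card_extract[OF odd_pos[OF assms], of \<rho> y] assms by (metis dvd_triv_left le_neq_implies_less)
  have ge': "m \<le> 2 * card (extract_indices m \<rho>' y')"
    using odd_pos[OF assms] by (rule card_extract)
  show "m < card (extract_indices m \<rho> y) + card (extract_indices m \<rho>' y')"
    using ge ge' by linarith
qed (auto simp: extract_indices_def)

lemma extract_near_centre:
  assumes i: "i \<in> extract_indices m rho1 x"
    and S: "S \<subseteq> {..<m}" "m < 2 * card S"
    and c: "\<And>k. k \<in> S \<Longrightarrow> norm (x k - c) \<le> r" and "0 \<le> r"
  shows "norm (x i - c) \<le> 3 * r"
proof -
  have "norm (x j - x k) \<le> 2 * r" if "j \<in> S" "k \<in> S" for j k
    using norm_triangle_ineq4[of "x j - c" "x k - c"] c[OF that(1)] c[OF that(2)] by simp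
  then have "\<exists>k\<in>S. rho1 (x i) (x k) \<le> ereal (2 * r)"
    using \<open>0 \<le> r\<close> by (intro extract_near_majority[OF i S]) (auto simp: rho1_def)
  then obtain k where "k \<in> S" "norm (x i - x k) \<le> 2 * r"
    by (auto simp: rho1_def)
  then show ?thesis
    using norm_triangle_ineq[of "x i - x k" "x k - c"] c[of k] by simp
qed

lemma minimal_radius_nonempty:
  assumes "0 < m"
  shows "minimal_radius m v \<noteq> {}"
proof -
  have "is_arg_min (radius m rho1 v) (\<lambda>k. k < m) (arg_min_on (radius m rho1 v) {..<m})"
    using assms arg_min_if_finite[of "{..<m}" "radius m rho1 v"] by (auto simp: is_arg_min_def)
  then show ?thesis
    by (auto simp: minimal_radius_def)
qed

lemma minimal_radius_near_majority:
  assumes i: "i \<in> minimal_radius m v"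
    and S: "S \<subseteq> {..<m}" "m < 2 * card S" and c: "\<And>j. j \<in> S \<Longrightarrow> norm (v j - c) \<le> r"
  shows "norm (v i - c) \<le> 3 * r"
proof -
  have m: "0 < m"
    using S by (cases m) auto
  obtain j where j: "j \<in> S"
    using S by fastforce
  have r: "0 \<le> r"
    using c[OF j] norm_ge_zero order_trans by blast
  have near: "norm (v j - v k) \<le> 2 * r" if "j \<in> S" "k \<in> S" for j k
    using norm_triangle_ineq4[of "v j - c" "v k - c"] c[OF that(1)] c[OF that(2)] by simp
  have ri: "radius m rho1 v i \<le> radius m rho1 v j"
    using i subsetD[OF S(1) j] by (simp add: minimal_radius_def is_arg_min_linorder)
  have "card S \<le> card {k. k < m \<and> rho1 (v j) (v k) \<le> ereal (2 * r)}"
    using S near[OF j] by (intro card_mono) (auto simp: rho1_def)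
  then have "radius m rho1 v j \<le> ereal (2 * r)"
    using r S by (simp add: radius_le_iff[OF m])
  with ri have "radius m rho1 v i \<le> ereal (2 * r)"
    by simp
  then have N: "m < 2 * card {k. k < m \<and> rho1 (v i) (v k) \<le> ereal (2 * r)}" (is "_ < 2 * card ?N")
    by (simp add: radius_le_iff[OF m])
  have "S \<inter> ?N \<noteq> {}"
    using S N by (intro majorities_meet) auto
  then obtain k where "k \<in> S" "norm (v i - v k) \<le> 2 * r"
    by (auto simp: rho1_def)
  then show ?thesis
    using norm_triangle_ineq[of "v i - v k" "v k - c"] c[of k] by simp
qed

section \<open>Execution of the procedures\<close>

lemma run_and_then:
  "run A G (and_then p k) us zs =
     (let (r, as, gs) = run A G p us zs;
          (r', as', gs') = run A G (k r) (\<lambda>n. us (n + length as)) (\<lambda>n. zs (n + length gs))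
      in (r', as @ as', gs @ gs'))"
  by (induction p arbitrary: us zs) (simp_all add: Let_def case_prod_beta)

lemma run_repeat_Query_Min:
  "run A G (repeat_proc m (Query_Min \<epsilon> Return)) us zs
     = (map (\<lambda>i. A \<epsilon> (us i)) [0..<m], replicate m \<epsilon>, [])"
  by (induction m arbitrary: us)
    (simp_all add: run_and_then Let_def case_prod_beta map_upt_Suc del: upt_Suc)

lemma run_repeat_Query_Grad:
  "run A G (repeat_proc s (Query_Grad x Return)) us zs
     = (map (\<lambda>j. G x (zs j)) [0..<s], [], replicate s x)"
  by (induction s arbitrary: zs)
    (simp_all add: run_and_then Let_def case_prod_beta map_upt_Suc del: upt_Suc)

lemma run_repeat_average:
  "run A G (repeat_proc m (and_then (repeat_proc s (Query_Grad x Return)) (\<lambda>gs. Return (average gs))))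
       us zs
     = (map (\<lambda>k. average (map (\<lambda>j. G x (zs (k * s + j))) [0..<s])) [0..<m], [], replicate (m * s) x)"
  by (induction m arbitrary: zs)
    (simp_all add: run_and_then run_repeat_Query_Grad Let_def case_prod_beta map_upt_Suc
      replicate_add ac_simps del: upt_Suc)

lemma vec_of_list_map_upt: "vec_of_list m (map F [0..<m]) = (\<lambda>i\<in>{..<m}. F i)"
  by (auto simp: vec_of_list_def)

lemma run_robust_gap:
  fixes A :: "real \<Rightarrow> 'u \<Rightarrow> 'a::euclidean_space" and us :: "nat \<Rightarrow> 'u" and zs :: "nat \<Rightarrow> 'z"
    and m :: nat and \<epsilon> \<sigma> \<kappa> \<mu> :: real and G :: "'a \<Rightarrow> 'z \<Rightarrow> 'a" and sel1 :: "(nat \<Rightarrow> 'a) \<Rightarrow> nat"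
    and tie :: "'a \<Rightarrow> (nat \<Rightarrow> 'a) \<Rightarrow> nat"
  defines "x \<equiv> (\<lambda>i\<in>{..<m}. A \<epsilon> (us i))"
    and "s \<equiv> nat \<lceil>3 * \<sigma>\<^sup>2 / (\<kappa> * sqrt (\<mu> * \<epsilon>))\<^sup>2\<rceil>"
  defines "v \<equiv> (\<lambda>k\<in>{..<m}. average (map (\<lambda>j. G (x (sel1 x)) (zs (k * s + j))) [0..<s]))"
  defines "w \<equiv> v (tie (x (sel1 x)) v)"
  shows "run A G (robust_gap sel1 tie sel2 h \<kappa> \<mu> \<sigma> m \<epsilon>) us zs =
    (if extract_indices m rho1 x \<inter> extract_indices m (rho2 h w) x = {} then None
       else Some (x (sel2 x w)),
     replicate m \<epsilon>, replicate (m * s) (x (sel1 x)))"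
  unfolding robust_gap_def robust_gradient_def
  by (simp add: run_and_then run_repeat_Query_Min run_repeat_average Let_def vec_of_list_map_upt
      del: restrict_apply flip: x_def s_def v_def w_def)

section \<open>Smooth and strongly convex functions\<close>

lemma smooth_fun_GDERIV:
  assumes "smooth_fun L g"
  shows "GDERIV g x :> gradient g x"
proof -
  have "D = D'" if "GDERIV g x :> D" "GDERIV g x :> D'" for D D'
  proof -
    have "(\<lambda>h. h \<bullet> D) = (\<lambda>h. h \<bullet> D')"
      using that unfolding gderiv_def by (rule has_derivative_unique)
    then show ?thesis
      by (metis vector_eq_ldot)
  qed
  moreover have "\<exists>D. GDERIV g x :> D"
    using assms by (simp add: smooth_fun_def)
  ultimately show ?thesis
    unfolding gradient_def by (blast intro: theI')
qed

lemma DERIV_along_line: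
  fixes y d :: "'a::euclidean_space"
  assumes "GDERIV g (y + t *\<^sub>R d) :> D"
  shows "((\<lambda>t. g (y + t *\<^sub>R d)) has_real_derivative D \<bullet> d) (at t)"
proof -
  have "((\<lambda>t. y + t *\<^sub>R d) has_derivative (\<lambda>h. 0 + h *\<^sub>R d)) (at t)"
    by (intro has_derivative_add has_derivative_const has_derivative_scaleR_left has_derivative_ident)
  then have "((\<lambda>t. g (y + t *\<^sub>R d)) has_derivative (\<lambda>h. (0 + h *\<^sub>R d) \<bullet> D)) (at t)"
    using assms unfolding gderiv_def by (rule has_derivative_compose)
  moreover have "(\<lambda>h. (0 + h *\<^sub>R d) \<bullet> D) = (*) (D \<bullet> d)"
    by (simp add: fun_eq_iff inner_commute)
  ultimately show ?thesis
    by (simp add: has_field_derivative_def)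
qed

lemma smooth_fun_upper_bound:
  assumes "smooth_fun L g"
  shows "g x \<le> g y + gradient g y \<bullet> (x - y) + L / 2 * (norm (x - y))\<^sup>2"
proof -
  let ?d = "x - y"
  let ?\<phi> = "\<lambda>t. g (y + t *\<^sub>R ?d) - t * (gradient g y \<bullet> ?d) - L / 2 * t\<^sup>2 * (norm ?d)\<^sup>2"
  have "?\<phi> 0 \<ge> ?\<phi> 1"
  proof (rule DERIV_nonpos_imp_nonincreasing[where f="?\<phi>"])
    fix t :: real
    assume t: "0 \<le> t" "t \<le> 1"
    let ?z = "y + t *\<^sub>R ?d"
    have "(?\<phi> has_real_derivative
        gradient g ?z \<bullet> ?d - gradient g y \<bullet> ?d - L * t * (norm ?d)\<^sup>2) (at t)"
      using DERIV_along_line[where y=y and t=t and d="?d", OF smooth_fun_GDERIV[OF assms]]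
      by (auto intro!: derivative_eq_intros)
    moreover have "(gradient g ?z - gradient g y) \<bullet> ?d \<le> L * t * (norm ?d)\<^sup>2"
    proof -
      have "norm (gradient g ?z - gradient g y) \<le> L * norm (?z - y)"
        using assms lipschitz_onD[of L UNIV "gradient g" ?z y] by (simp add: smooth_fun_def dist_norm)
      then have "norm (gradient g ?z - gradient g y) * norm ?d \<le> (L * (t * norm ?d)) * norm ?d"
        using t by (intro mult_right_mono) auto
      then show ?thesis
        using norm_cauchy_schwarz[of "gradient g ?z - gradient g y" ?d]
        by (simp add: power2_eq_square mult_ac)
    qed
    ultimately show "\<exists>D. (?\<phi> has_real_derivative D) (at t) \<and> D \<le> 0"
      by (auto simp: inner_diff_left)
  qed simp
  then show ?thesis
    by simp
qed

lemma strongly_convex_lower_bound: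
  assumes "strongly_convex \<mu> g" and D: "GDERIV g y :> D"
  shows "g x \<ge> g y + D \<bullet> (x - y) + \<mu> / 2 * (norm (x - y))\<^sup>2"
proof -
  let ?d = "x - y"
  let ?\<psi> = "\<lambda>t. g (y + t *\<^sub>R ?d) - \<mu> / 2 * (norm (y + t *\<^sub>R ?d))\<^sup>2"
  have "convex_on UNIV ?\<psi>"
  proof (rule convex_onI)
    fix t a b :: real
    assume "0 < t" "t < 1"
    moreover have "y + ((1 - t) *\<^sub>R a + t *\<^sub>R b) *\<^sub>R ?d
        = (1 - t) *\<^sub>R (y + a *\<^sub>R ?d) + t *\<^sub>R (y + b *\<^sub>R ?d)"
      by (simp add: algebra_simps)
    ultimately show "?\<psi> ((1 - t) *\<^sub>R a + t *\<^sub>R b) \<le> (1 - t) * ?\<psi> a + t * ?\<psi> b"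
      using convex_onD[OF assms(1)[unfolded strongly_convex_def], of t "y + a *\<^sub>R ?d" "y + b *\<^sub>R ?d"]
      by simp
  qed simp
  moreover have "(?\<psi> has_real_derivative (D \<bullet> ?d - \<mu> * (y \<bullet> ?d))) (at 0)"
  proof -
    have "((\<lambda>t. (norm (y + t *\<^sub>R ?d))\<^sup>2) has_real_derivative 2 * (y \<bullet> ?d)) (at 0)"
      unfolding power2_norm_eq_inner
      by (rule has_derivative_imp_has_field_derivative)
        (auto intro!: derivative_eq_intros simp: inner_commute inner_add_left inner_add_right)
    moreover have "((\<lambda>t. g (y + t *\<^sub>R ?d)) has_real_derivative D \<bullet> ?d) (at 0)"
      using D by (intro DERIV_along_line) simp
    ultimately show ?thesis
      using DERIV_diff DERIV_cmult[of _ "2 * (y \<bullet> ?d)" 0 UNIV "\<mu> / 2"] by fastforce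
  qed
  ultimately have "?\<psi> 1 - ?\<psi> 0 \<ge> (D \<bullet> ?d - \<mu> * (y \<bullet> ?d)) * (1 - 0)"
    by (intro convex_on_imp_above_tangent[of UNIV]) auto
  moreover have "(norm x)\<^sup>2 = (norm y)\<^sup>2 + 2 * (y \<bullet> ?d) + (norm ?d)\<^sup>2"
    by (simp add: power2_norm_eq_inner inner_diff_left inner_diff_right inner_commute)
  ultimately show ?thesis
    by (simp add: algebra_simps)
qed

lemma strong_convexity_le_smoothness:
  fixes g :: "'a::euclidean_space \<Rightarrow> real"
  assumes "smooth_fun L g" "strongly_convex \<mu> g"
  shows "\<mu> \<le> L"
proof -
  obtain b :: 'a where "b \<in> Basis"
    using nonempty_Basis by blast
  then show ?thesis
    using smooth_fun_upper_bound[OF assms(1), of b 0]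
      strongly_convex_lower_bound[OF assms(2) smooth_fun_GDERIV[OF assms(1)], of 0 b]
    by simp
qed

section \<open>Closed convex functions\<close>

lemma borel_measurable_closed_convex_fun:
  assumes "closed_convex_fun h"
  shows "h \<in> borel_measurable borel"
  unfolding borel_measurable_iff_Iic_ereal
proof
  fix a :: ereal
  have "closed (h -` {..ereal r})" for r
  proof -
    have "h -` {..ereal r} = (\<lambda>x. (x, r)) -` ereal_epigraph h"
      by (auto simp: ereal_epigraph_def)
    also have "closed \<dots>"
      using assms by (intro continuous_closed_vimage) (auto simp: closed_convex_fun_def intro!: continuous_intros)
    finally show ?thesis .
  qed
  moreover have "h -` {..-\<infinity>} = {}"
    using assms by (auto simp: closed_convex_fun_def)
  moreover have "h -` {..\<infinity>} = UNIV"
    by auto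
  ultimately show "h -` {..a} \<inter> space borel \<in> sets borel"
    by (cases a) auto
qed

lemma closed_convex_fun_le:
  assumes "closed_convex_fun h" "h x \<le> ereal a" "h y \<le> ereal b" "0 \<le> t" "t \<le> 1"
  shows "h (x + t *\<^sub>R (y - x)) \<le> ereal (a + t * (b - a))"
proof -
  have "(1 - t) *\<^sub>R (x, a) + t *\<^sub>R (y, b) \<in> ereal_epigraph h"
    using assms by (intro convexD) (auto simp: closed_convex_fun_def ereal_epigraph_def)
  then show ?thesis
    by (simp add: ereal_epigraph_def algebra_simps)
qed

section \<open>Points of small optimality gap\<close>

locale composite_minimizer =
  fixes g :: "'a::euclidean_space \<Rightarrow> real" and h :: "'a \<Rightarrow> ereal" and L \<mu> :: real and xbar :: 'a
  assumes \<mu>_pos: "0 < \<mu>"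
    and smooth: "smooth_fun L g" and strong: "strongly_convex \<mu> g"
    and closed_convex: "closed_convex_fun h"
    and minimizer: "\<And>y. ereal (g xbar) + h xbar \<le> ereal (g y) + h y"
begin

abbreviation f :: "'a \<Rightarrow> ereal" where
  "f x \<equiv> ereal (g x) + h x"

lemma L_pos: "0 < L" and one_le_\<kappa>: "1 \<le> L / \<mu>"
  using \<mu>_pos strong_convexity_le_smoothness[OF smooth strong] by auto

lemma h_xbar: "\<bar>h xbar\<bar> \<noteq> \<infinity>"
proof -
  obtain x where "h x \<noteq> \<infinity>"
    using closed_convex by (auto simp: closed_convex_fun_def)
  then have "f x \<noteq> \<infinity>"
    by simp
  then have "h xbar \<noteq> \<infinity>"
    using minimizer[of x] by auto
  then show ?thesis
    using closed_convex by (auto simp: closed_convex_fun_def)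
qed

lemma INF_f: "(INF y. f y) = f xbar"
  using minimizer by (intro antisym INF_lower INF_greatest) auto

definition bregman :: "'a \<Rightarrow> real" where
  "bregman x = real_of_ereal (h x) - real_of_ereal (h xbar) + gradient g xbar \<bullet> (x - xbar)"

lemma D_h_eq:
  assumes "h x \<noteq> \<infinity>"
  shows "D_h g h x xbar = ereal (bregman x)"
  using assms h_xbar closed_convex
  by (cases "h x"; cases "h xbar") (auto simp: D_h_def bregman_def closed_convex_fun_def)

lemma gap_eq:
  assumes "h x \<noteq> \<infinity>"
  shows "f x - (INF y. f y) = ereal (g x - g xbar - gradient g xbar \<bullet> (x - xbar) + bregman x)"
  using assms h_xbar closed_convex unfolding INF_f
  by (cases "h x"; cases "h xbar") (auto simp: bregman_def closed_convex_fun_def)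

lemma rho2_eq:
  assumes "h x \<noteq> \<infinity>" "h y \<noteq> \<infinity>"
  shows "rho2 h w x y = ereal \<bar>bregman x - bregman y + (w - gradient g xbar) \<bullet> (x - y)\<bar>"
  using assms closed_convex
  by (cases "h x"; cases "h y")
    (auto simp: rho2_def bregman_def closed_convex_fun_def inner_diff_left inner_diff_right)

lemma rho2_finiteD:
  assumes "rho2 h w x y \<le> ereal r"
  shows "h x \<noteq> \<infinity>"
  using assms by (auto simp: rho2_def)

lemma bregman_nonneg:
  assumes "h x \<noteq> \<infinity>"
  shows "0 \<le> bregman x"
proof -
  obtain a b where a: "h xbar = ereal a" and b: "h x = ereal b"
    using assms h_xbar closed_convex by (cases "h x"; cases "h xbar") (auto simp: closed_convex_fun_def)
  let ?d = "x - xbar"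
  let ?c = "L / 2 * (norm ?d)\<^sup>2"
  have "0 \<le> bregman x + ?c * t" if "0 < t" "t \<le> 1" for t
  proof -
    let ?z = "xbar + t *\<^sub>R ?d"
    have "ereal (g xbar) + h xbar \<le> ereal (g ?z) + h ?z"
      by (rule minimizer)
    also have "\<dots> \<le> ereal (g ?z) + ereal (a + t * (b - a))"
      using that a b by (intro add_left_mono closed_convex_fun_le[OF closed_convex]) auto
    finally have "g xbar + a \<le> g ?z + (a + t * (b - a))"
      by (simp add: a)
    moreover have "g ?z \<le> g xbar + t * (gradient g xbar \<bullet> ?d) + ?c * t\<^sup>2"
      using smooth_fun_upper_bound[OF smooth, of ?z xbar] by (simp add: power_mult_distrib mult_ac)
    ultimately have "0 \<le> t * (bregman x + ?c * t)"
      by (simp add: bregman_def a b algebra_simps power2_eq_square)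
    then show ?thesis
      using that by (simp add: zero_le_mult_iff)
  qed
  then have "eventually (\<lambda>t. 0 \<le> bregman x + ?c * t) (at_right 0)"
    by (auto simp: eventually_at_right_field intro!: exI[of _ 1])
  moreover have "((\<lambda>t. bregman x + ?c * t) \<longlongrightarrow> bregman x + ?c * 0) (at_right 0)"
    by (intro tendsto_intros)
  ultimately show ?thesis
    using tendsto_lowerbound trivial_limit_at_right_real by fastforce
qed

lemma small_gap:
  assumes "f x - (INF y. f y) \<le> ereal \<epsilon>"
  shows "h x \<noteq> \<infinity>" and "norm (x - xbar) \<le> sqrt (2 * \<epsilon> / \<mu>)" and "bregman x \<le> \<epsilon>"
proof -
  show fin: "h x \<noteq> \<infinity>"
    using assms h_xbar unfolding INF_f by (cases "h xbar") auto
  have gap: "g x - g xbar - gradient g xbar \<bullet> (x - xbar) + bregman x \<le> \<epsilon>"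
    using assms unfolding gap_eq[OF fin] by simp
  have lower: "\<mu> / 2 * (norm (x - xbar))\<^sup>2 \<le> g x - g xbar - gradient g xbar \<bullet> (x - xbar)"
    using strongly_convex_lower_bound[OF strong smooth_fun_GDERIV[OF smooth], of xbar x] by simp
  moreover have "0 \<le> \<mu> / 2 * (norm (x - xbar))\<^sup>2"
    using \<mu>_pos by simp
  ultimately show "bregman x \<le> \<epsilon>"
    using gap by linarith
  have "\<mu> / 2 * (norm (x - xbar))\<^sup>2 \<le> \<epsilon>"
    using gap lower bregman_nonneg[OF fin] by linarith
  then show "norm (x - xbar) \<le> sqrt (2 * \<epsilon> / \<mu>)"
    using \<mu>_pos by (intro real_le_rsqrt) (simp add: field_simps)
qed

lemma robust_gap_guarantee:
  assumes "0 < \<epsilon>"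
    and S: "S \<subseteq> {..<m}" "m < 2 * card S"
    and gap: "\<And>k. k \<in> S \<Longrightarrow> f (x k) - (INF y. f y) \<le> ereal \<epsilon>"
    and i1: "i1 \<in> extract_indices m rho1 x"
    and w: "norm (w - gradient g (x i1)) \<le> 3 * (L / \<mu> * sqrt (\<mu> * \<epsilon>))"
    and i: "i \<in> extract_indices m rho1 x" "i \<in> extract_indices m (rho2 h w) x"
  shows "norm (x i - xbar) \<le> 3 * sqrt (2 * \<epsilon> / \<mu>)"
    and "D_h g h (x i) xbar \<le> ereal (65 * (L / \<mu>) * \<epsilon>)"
    and "f (x i) - (INF y. f y) \<le> ereal (74 * (L / \<mu>) * \<epsilon>)"
proof -
  let ?\<kappa> = "L / \<mu>" and ?\<delta> = "sqrt (2 * \<epsilon> / \<mu>)" and ?v = "w - gradient g xbar"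
  have \<delta>: "0 \<le> ?\<delta>"
    using \<mu>_pos \<open>0 < \<epsilon>\<close> by simp
  have near: "norm (x j - xbar) \<le> 3 * ?\<delta>" if "j \<in> extract_indices m rho1 x" for j
    using small_gap(2)[OF gap] \<delta> by (intro extract_near_centre[OF that S])
  then show x: "norm (x i - xbar) \<le> 3 * ?\<delta>"
    using i by blast

  have eq1: "?\<kappa> * sqrt (\<mu> * \<epsilon>) * ?\<delta> = sqrt 2 * ?\<kappa> * \<epsilon>"
  proof -
    have "sqrt (\<mu> * \<epsilon>) * ?\<delta> = sqrt (2 * \<epsilon>\<^sup>2)"
      using \<mu>_pos by (simp add: field_simps power2_eq_square flip: real_sqrt_mult)
    also have "\<dots> = sqrt 2 * \<epsilon>"
      using \<open>0 < \<epsilon>\<close> by (simp add: real_sqrt_mult)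
    finally show ?thesis
      by simp
  qed
  have eq2: "L * ?\<delta> * ?\<delta> = 2 * ?\<kappa> * \<epsilon>"
    using \<mu>_pos \<open>0 < \<epsilon>\<close> by (simp add: mult.assoc)
  have v: "norm ?v \<le> 3 * (?\<kappa> * sqrt (\<mu> * \<epsilon>)) + 3 * (L * ?\<delta>)"
  proof -
    have "norm (gradient g (x i1) - gradient g xbar) \<le> L * norm (x i1 - xbar)"
      using smooth lipschitz_onD[of L UNIV "gradient g" "x i1" xbar]
      by (simp add: smooth_fun_def dist_norm)
    also have "\<dots> \<le> L * (3 * ?\<delta>)"
      using L_pos near[OF i1] by (intro mult_left_mono) auto
    finally show ?thesis
      using w norm_triangle_ineq[of "w - gradient g (x i1)" "gradient g (x i1) - gradient g xbar"]
      by simp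
  qed
  have inner_v: "\<bar>?v \<bullet> (y - z)\<bar> \<le> a * (3 * sqrt 2 + 6) * ?\<kappa> * \<epsilon>"
    if "norm (y - z) \<le> a * ?\<delta>" for y z a
  proof -
    have "\<bar>?v \<bullet> (y - z)\<bar> \<le> norm ?v * norm (y - z)"
      by (rule Cauchy_Schwarz_ineq2)
    also have "\<dots> \<le> (3 * (?\<kappa> * sqrt (\<mu> * \<epsilon>)) + 3 * (L * ?\<delta>)) * (a * ?\<delta>)"
      using v that order_trans[OF norm_ge_zero v] by (intro mult_mono) auto
    also have "\<dots> = a * (3 * (?\<kappa> * sqrt (\<mu> * \<epsilon>) * ?\<delta>) + 3 * (L * ?\<delta> * ?\<delta>))"
      by (simp only: distrib_left distrib_right mult_ac)
    also have "\<dots> = a * (3 * sqrt 2 + 6) * ?\<kappa> * \<epsilon>"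
      unfolding eq1 eq2 by (simp add: algebra_simps)
    finally show ?thesis .
  qed

  let ?r = "\<epsilon> + 2 * (3 * sqrt 2 + 6) * ?\<kappa> * \<epsilon>"
  have "\<exists>k\<in>S. rho2 h w (x i) (x k) \<le> ereal ?r"
  proof (rule extract_near_majority[OF i(2) S])
    show "0 \<le> ereal ?r"
      using \<open>0 < \<epsilon>\<close> L_pos \<mu>_pos by simp
    fix j k assume jk: "j \<in> S" "k \<in> S"
    note j = small_gap[OF gap[OF jk(1)]] and k = small_gap[OF gap[OF jk(2)]]
    have "norm (x j - x k) \<le> 2 * ?\<delta>"
      using norm_triangle_ineq4[of "x j - xbar" "x k - xbar"] j(2) k(2) by simp
    then have "\<bar>?v \<bullet> (x j - x k)\<bar> \<le> 2 * (3 * sqrt 2 + 6) * ?\<kappa> * \<epsilon>"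
      by (rule inner_v)
    moreover have "\<bar>bregman (x j) - bregman (x k)\<bar> \<le> \<epsilon>"
      using j(3) k(3) bregman_nonneg[OF j(1)] bregman_nonneg[OF k(1)] by linarith
    ultimately show "rho2 h w (x j) (x k) \<le> ereal ?r"
      unfolding rho2_eq[OF j(1) k(1)] by simp
  qed
  then obtain k where k: "k \<in> S" and rho2: "rho2 h w (x i) (x k) \<le> ereal ?r"
    by blast
  note good = small_gap[OF gap[OF k]]
  have fin: "h (x i) \<noteq> \<infinity>"
    using rho2 by (rule rho2_finiteD)
  have "norm (x i - x k) \<le> 4 * ?\<delta>"
    using norm_triangle_ineq4[of "x i - xbar" "x k - xbar"] x good(2) by simp
  then have "\<bar>?v \<bullet> (x i - x k)\<bar> \<le> 4 * (3 * sqrt 2 + 6) * ?\<kappa> * \<epsilon>"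
    by (rule inner_v)
  moreover have "\<bar>bregman (x i) - bregman (x k) + ?v \<bullet> (x i - x k)\<bar> \<le> ?r"
    using rho2 unfolding rho2_eq[OF fin good(1)] by simp
  moreover have "6 * (3 * sqrt 2 + 6) * ?\<kappa> * \<epsilon>
      = 2 * (3 * sqrt 2 + 6) * ?\<kappa> * \<epsilon> + 4 * (3 * sqrt 2 + 6) * ?\<kappa> * \<epsilon>"
    by (simp only: flip: distrib_right) simp
  ultimately have "bregman (x i) \<le> 2 * \<epsilon> + 6 * (3 * sqrt 2 + 6) * ?\<kappa> * \<epsilon>"
    using good(3) by linarith
  also have "\<dots> \<le> 2 * (?\<kappa> * \<epsilon>) + 63 * (?\<kappa> * \<epsilon>)"
  proof -
    have "sqrt 2 \<le> 3 / 2"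
      by (rule real_le_lsqrt) (auto simp: power2_eq_square)
    moreover have "0 \<le> ?\<kappa> * \<epsilon>"
      using \<open>0 < \<epsilon>\<close> L_pos \<mu>_pos by simp
    ultimately have "6 * (3 * sqrt 2 + 6) * (?\<kappa> * \<epsilon>) \<le> 63 * (?\<kappa> * \<epsilon>)"
      by (intro mult_right_mono) auto
    moreover have "1 * \<epsilon> \<le> ?\<kappa> * \<epsilon>"
      using \<open>0 < \<epsilon>\<close> one_le_\<kappa> by (intro mult_right_mono) auto
    ultimately show ?thesis
      by (simp add: mult.assoc)
  qed
  finally have D: "bregman (x i) \<le> 65 * ?\<kappa> * \<epsilon>"
    by simp
  then show "D_h g h (x i) xbar \<le> ereal (65 * ?\<kappa> * \<epsilon>)"
    by (simp add: D_h_eq[OF fin])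
  have "g (x i) - g xbar - gradient g xbar \<bullet> (x i - xbar) \<le> L / 2 * (norm (x i - xbar))\<^sup>2"
    using smooth_fun_upper_bound[OF smooth, of "x i" xbar] by simp
  also have "\<dots> \<le> L / 2 * (3 * ?\<delta>)\<^sup>2"
    using x L_pos by (intro mult_left_mono power_mono) auto
  also have "\<dots> = 9 * ?\<kappa> * \<epsilon>"
    using eq2 by (simp add: power2_eq_square field_simps)
  finally show "f (x i) - (INF y. f y) \<le> ereal (74 * ?\<kappa> * \<epsilon>)"
    using D unfolding gap_eq[OF fin] by simp
qed

end

section \<open>Concentration\<close>

lemma (in prob_space) majority_prob:
  assumes indep: "indep_vars (\<lambda>_. N) Y {..<m}" and S: "S \<in> sets N"
    and p: "\<And>k. k < m \<Longrightarrow> prob {\<omega> \<in> space M. Y k \<omega> \<in> S} \<ge> 2 / 3"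
  shows "prob {\<omega> \<in> space M. m < 2 * card {k. k < m \<and> Y k \<omega> \<in> S}} \<ge> 1 - exp (- real m / 18)"
proof (cases "m = 0")
  case False
  have Y [measurable]: "Y k \<in> M \<rightarrow>\<^sub>M N" if "k < m" for k
    using indep that by (auto simp: indep_vars_def)
  let ?X = "\<lambda>k \<omega>. indicat_real S (Y k \<omega>)"
  interpret Hoeffding_ineq M "{..<m}" ?X "\<lambda>_. 0" "\<lambda>_. 1" "\<Sum>k<m. expectation (?X k)"
  proof unfold_locales
    show "indep_vars (\<lambda>_. borel) ?X {..<m}"
      using S by (intro indep_vars_compose2[OF indep]) simp
  qed (auto simp: indicator_def)
  let ?E = "\<Sum>k<m. expectation (?X k)"
  let ?B = "{\<omega> \<in> space M. (\<Sum>k<m. ?X k \<omega>) \<le> ?E - (?E - real m / 2)}"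
  have "expectation (?X k) \<ge> 2 / 3" if "k < m" for k
  proof -
    have "{\<omega> \<in> space M. Y k \<omega> \<in> S} \<in> events"
      using that S by measurable
    moreover have "expectation (?X k) = expectation (indicator {\<omega> \<in> space M. Y k \<omega> \<in> S})"
      by (intro Bochner_Integration.integral_cong) (auto simp: indicator_def)
    ultimately show ?thesis
      using p[OF that] by simp
  qed
  then have "(\<Sum>k<m. 2 / 3) \<le> ?E"
    by (intro sum_mono) auto
  then have E: "real m / 6 \<le> ?E - real m / 2"
    by simp
  have "prob ?B \<le> exp (- 2 * (?E - real m / 2)\<^sup>2 / (\<Sum>k<m. (1 - 0)\<^sup>2))"
    using E False by (intro Hoeffding_ineq_le) auto
  also have "\<dots> \<le> exp (- 2 * (real m / 6)\<^sup>2 / (\<Sum>k<m. (1 - 0)\<^sup>2))"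
    using E False by (auto intro!: divide_right_mono power_mono)
  also have "\<dots> = exp (- real m / 18)"
    using False by (simp add: power2_eq_square)
  finally have B: "prob ?B \<le> exp (- real m / 18)" .
  have "space M - ?B = {\<omega> \<in> space M. m < 2 * card {k. k < m \<and> Y k \<omega> \<in> S}}"
  proof -
    have "(\<Sum>k<m. ?X k \<omega>) = real (card {k. k < m \<and> Y k \<omega> \<in> S})" for \<omega>
    proof -
      have "(\<Sum>k<m. ?X k \<omega>) = (\<Sum>k<m. of_bool (Y k \<omega> \<in> S))"
        by (intro sum.cong) (auto simp: indicator_def)
      also have "\<dots> = real (card ({..<m} \<inter> {k. Y k \<omega> \<in> S}))"
        by simp
      also have "{..<m} \<inter> {k. Y k \<omega> \<in> S} = {k. k < m \<and> Y k \<omega> \<in> S}"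
        by auto
      finally show ?thesis .
    qed
    then show ?thesis
      by auto
  qed
  moreover have "?B \<in> events"
    using S by measurable
  ultimately show ?thesis
    using B prob_compl[of ?B] by simp
qed simp

lemma (in prob_space) mean_variance:
  fixes X :: "'i \<Rightarrow> 'a \<Rightarrow> 'b::euclidean_space"
  assumes indep: "indep_vars (\<lambda>_. borel) X I" and I: "finite I" "I \<noteq> {}"
    and int: "\<And>i. i \<in> I \<Longrightarrow> integrable M (X i)"
    and mean: "\<And>i. i \<in> I \<Longrightarrow> expectation (X i) = c"
    and int2: "\<And>i. i \<in> I \<Longrightarrow> integrable M (\<lambda>\<omega>. (norm (X i \<omega> - c))\<^sup>2)"
    and var: "\<And>i. i \<in> I \<Longrightarrow> expectation (\<lambda>\<omega>. (norm (X i \<omega> - c))\<^sup>2) \<le> V"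
  defines "Y \<equiv> (\<lambda>\<omega>. (1 / real (card I)) *\<^sub>R (\<Sum>i\<in>I. X i \<omega>))"
  shows "integrable M (\<lambda>\<omega>. (norm (Y \<omega> - c))\<^sup>2)"
    and "expectation (\<lambda>\<omega>. (norm (Y \<omega> - c))\<^sup>2) \<le> V / card I"
proof -
  let ?Z = "\<lambda>i \<omega>. X i \<omega> - c"
  let ?n = "real (card I)"
  have n: "0 < ?n"
    using I by (simp add: card_gt_0_iff)
  have meas [measurable]: "X i \<in> borel_measurable M" if "i \<in> I" for i
    using int[OF that] by simp
  have eq: "(norm (Y \<omega> - c))\<^sup>2 = (\<Sum>i\<in>I. \<Sum>j\<in>I. ?Z i \<omega> \<bullet> ?Z j \<omega>) / ?n\<^sup>2" for \<omega>
  proof -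
    have "Y \<omega> - c = (1 / ?n) *\<^sub>R (\<Sum>i\<in>I. ?Z i \<omega>)"
      using n by (simp add: Y_def sum_subtractf scaleR_right_diff_distrib sum_constant_scaleR)
    then show ?thesis
      by (simp add: power_divide power2_norm_eq_inner inner_sum_left inner_sum_right inner_commute)
  qed
  have prod_int: "integrable M (\<lambda>\<omega>. ?Z i \<omega> \<bullet> ?Z j \<omega>)" if "i \<in> I" "j \<in> I" for i j
  proof (rule Bochner_Integration.integrable_bound)
    show "integrable M (\<lambda>\<omega>. (norm (?Z i \<omega>))\<^sup>2 + (norm (?Z j \<omega>))\<^sup>2)"
      using that by (intro Bochner_Integration.integrable_add int2)
    have "\<bar>x \<bullet> y\<bar> \<le> (norm x)\<^sup>2 + (norm y)\<^sup>2" for x y :: 'b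
    proof -
      have "\<bar>x \<bullet> y\<bar> \<le> norm x * norm y"
        by (rule Cauchy_Schwarz_ineq2)
      moreover have "2 * (norm x * norm y) \<le> (norm x)\<^sup>2 + (norm y)\<^sup>2"
        using sum_squares_bound[of "norm x" "norm y"] by simp
      moreover have "0 \<le> norm x * norm y"
        by simp
      ultimately show ?thesis
        by linarith
    qed
    then show "AE \<omega> in M. norm (?Z i \<omega> \<bullet> ?Z j \<omega>) \<le> norm ((norm (?Z i \<omega>))\<^sup>2 + (norm (?Z j \<omega>))\<^sup>2)"
      by auto
  qed (use that in measurable)
  then show "integrable M (\<lambda>\<omega>. (norm (Y \<omega> - c))\<^sup>2)"
    unfolding eq by (intro integrable_divide Bochner_Integration.integrable_sum)
  have cov: "expectation (\<lambda>\<omega>. ?Z i \<omega> \<bullet> ?Z j \<omega>) = 0" if ij: "i \<in> I" "j \<in> I" "i \<noteq> j" for i j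
  proof -
    have coord: "expectation (\<lambda>\<omega>. (?Z i \<omega> \<bullet> b) * (?Z j \<omega> \<bullet> b)) = 0"
      "integrable M (\<lambda>\<omega>. (?Z i \<omega> \<bullet> b) * (?Z j \<omega> \<bullet> b))" for b
    proof -
      have ind: "indep_vars (\<lambda>_. borel) (\<lambda>k \<omega>. ?Z k \<omega> \<bullet> b) {i, j}"
        using ij by (intro indep_vars_compose2[OF indep_vars_subset[OF indep]]) auto
      have int': "integrable M (\<lambda>\<omega>. ?Z k \<omega> \<bullet> b)" if "k \<in> {i, j}" for k
        using that ij by (auto intro!: integrable_inner_left int)
      have zero: "expectation (\<lambda>\<omega>. ?Z i \<omega> \<bullet> b) = 0"
        using ij by (simp add: int mean prob_space inner_diff_left)
      show "expectation (\<lambda>\<omega>. (?Z i \<omega> \<bullet> b) * (?Z j \<omega> \<bullet> b)) = 0"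
        using indep_vars_lebesgue_integral[OF _ ind int'] zero ij by simp
      show "integrable M (\<lambda>\<omega>. (?Z i \<omega> \<bullet> b) * (?Z j \<omega> \<bullet> b))"
        using indep_vars_integrable[OF _ ind int'] ij by simp
    qed
    then show ?thesis
      by (subst euclidean_inner) (simp add: Bochner_Integration.integral_sum)
  qed
  have "expectation (\<lambda>\<omega>. (norm (Y \<omega> - c))\<^sup>2)
      = (\<Sum>i\<in>I. \<Sum>j\<in>I. expectation (\<lambda>\<omega>. ?Z i \<omega> \<bullet> ?Z j \<omega>)) / ?n\<^sup>2"
    unfolding eq using prod_int
    by (simp add: Bochner_Integration.integral_sum Bochner_Integration.integrable_sum)
  also have "\<dots> = (\<Sum>i\<in>I. expectation (\<lambda>\<omega>. (norm (?Z i \<omega>))\<^sup>2)) / ?n\<^sup>2"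
  proof -
    have "(\<Sum>j\<in>I. expectation (\<lambda>\<omega>. ?Z i \<omega> \<bullet> ?Z j \<omega>)) = expectation (\<lambda>\<omega>. (norm (?Z i \<omega>))\<^sup>2)"
      if "i \<in> I" for i
    proof -
      have "(\<Sum>j\<in>I. expectation (\<lambda>\<omega>. ?Z i \<omega> \<bullet> ?Z j \<omega>))
          = (\<Sum>j\<in>I. if j = i then expectation (\<lambda>\<omega>. (norm (?Z i \<omega>))\<^sup>2) else 0)"
        using cov that by (intro sum.cong) (auto simp: power2_norm_eq_inner)
      then show ?thesis
        using that I by simp
    qed
    then show ?thesis
      by simp
  qed
  also have "\<dots> \<le> (\<Sum>i\<in>I. V) / ?n\<^sup>2"
    using var by (intro divide_right_mono sum_mono) auto
  also have "\<dots> = V / ?n"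
    using n by (simp add: power2_eq_square)
  finally show "expectation (\<lambda>\<omega>. (norm (Y \<omega> - c))\<^sup>2) \<le> V / card I" .
qed

lemma (in prob_space) mean_deviation:
  fixes X :: "'i \<Rightarrow> 'a \<Rightarrow> 'b::euclidean_space"
  assumes "indep_vars (\<lambda>_. borel) X I" "finite I" "I \<noteq> {}"
    and int: "\<And>i. i \<in> I \<Longrightarrow> integrable M (X i)"
    and "\<And>i. i \<in> I \<Longrightarrow> expectation (X i) = c"
    and "\<And>i. i \<in> I \<Longrightarrow> integrable M (\<lambda>\<omega>. (norm (X i \<omega> - c))\<^sup>2)"
    and "\<And>i. i \<in> I \<Longrightarrow> expectation (\<lambda>\<omega>. (norm (X i \<omega> - c))\<^sup>2) \<le> V"
    and "0 < e" and card: "3 * V / e\<^sup>2 \<le> card I"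
  defines "Y \<equiv> (\<lambda>\<omega>. (1 / real (card I)) *\<^sub>R (\<Sum>i\<in>I. X i \<omega>))"
  shows "prob {\<omega> \<in> space M. norm (Y \<omega> - c) \<le> e} \<ge> 2 / 3"
proof -
  note var = mean_variance[OF assms(1-7)]
  have n: "0 < real (card I)"
    using assms(2,3) by (simp add: card_gt_0_iff)
  have [measurable]: "Y \<in> borel_measurable M"
    unfolding Y_def using int by (intro borel_measurable_scaleR borel_measurable_sum) auto
  let ?B = "{\<omega> \<in> space M. (norm (Y \<omega> - c))\<^sup>2 \<ge> e\<^sup>2}"
  have "prob ?B \<le> expectation (\<lambda>\<omega>. (norm (Y \<omega> - c))\<^sup>2) / e\<^sup>2"
    using var(1) \<open>0 < e\<close> unfolding Y_def
    by (intro integral_Markov_inequality_measure[where A="space M"]) auto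
  also have "\<dots> \<le> (V / card I) / e\<^sup>2"
    using var(2) unfolding Y_def by (intro divide_right_mono) auto
  also have "\<dots> \<le> 1 / 3"
    using card n \<open>0 < e\<close> by (simp add: field_simps)
  finally have "1 - prob ?B \<ge> 2 / 3"
    by simp
  also have "1 - prob ?B = prob (space M - ?B)"
    by (intro prob_compl[symmetric]) measurable
  also have "\<dots> \<le> prob {\<omega> \<in> space M. norm (Y \<omega> - c) \<le> e}"
  proof (intro finite_measure_mono)
    show "space M - ?B \<subseteq> {\<omega> \<in> space M. norm (Y \<omega> - c) \<le> e}"
      using \<open>0 < e\<close> by (auto simp: not_le dest!: power_less_imp_less_base)
  qed measurable
  finally show ?thesis .
qed

lemma indep_vars_PiM_components:
  assumes "\<And>i. i \<in> I \<Longrightarrow> prob_space (N i)" and "I \<noteq> {}"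
  shows "prob_space.indep_vars (PiM I N) N (\<lambda>i \<omega>. \<omega> i) I"
proof -
  interpret prob_space "PiM I N"
    using assms by (intro prob_space_PiM)
  have "distr (PiM I N) (PiM I N) (\<lambda>\<omega>. \<lambda>i\<in>I. \<omega> i) = distr (PiM I N) (PiM I N) (\<lambda>\<omega>. \<omega>)"
    by (intro distr_cong) (auto simp: space_PiM)
  then show ?thesis
    using assms by (subst indep_vars_iff_distr_eq_PiM')
      (auto simp: distr_PiM_component cong: PiM_cong)
qed

lemma average_map_upt: "average (map F [0..<s]) = (1 / real s) *\<^sub>R (\<Sum>j<s. F j)"
  by (simp add: average_def lessThan_atLeast0 flip: sum_set_upt_conv_sum_list_nat)

lemma average_block:
  "average (map (\<lambda>j. F (k * s + j)) [0..<s]) = (1 / real s) *\<^sub>R (\<Sum>i\<in>{k * s..<k * s + s}. F i)"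
  using sum.shift_bounds_nat_ivl[of F 0 "k * s" s]
  by (simp add: average_map_upt lessThan_atLeast0 add.commute)

lemma estimator_majority:
  assumes grad: "stochastic_gradient_oracle g \<sigma> P G" and "0 < \<sigma>" "0 < e"
  defines "s \<equiv> nat \<lceil>3 * \<sigma>\<^sup>2 / e\<^sup>2\<rceil>" and "Z \<equiv> (\<Pi>\<^sub>M n\<in>(UNIV::nat set). P)"
  shows "measure Z {zs \<in> space Z. m < 2 * card {k. k < m \<and>
      norm (average (map (\<lambda>j. G x (zs (k * s + j))) [0..<s]) - gradient g x) \<le> e}}
    \<ge> 1 - exp (- real m / 18)"
proof -
  interpret P: prob_space P
    using grad by (simp add: stochastic_gradient_oracle_def)
  interpret Z: prob_space Z
    unfolding Z_def by (intro prob_space_PiM P.prob_space_axioms)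
  have joint: "(\<lambda>(x, z). G x z) \<in> borel_measurable (borel \<Otimes>\<^sub>M P)"
    using grad by (simp add: stochastic_gradient_oracle_def)
  have G [measurable]: "G x \<in> borel_measurable P"
    using measurable_Pair2[OF joint, of x] by simp
  let ?c = "gradient g x"
  let ?K = "\<lambda>k. {k * s..<k * s + s}"
  let ?v = "\<lambda>k zs. average (map (\<lambda>j. G x (zs (k * s + j))) [0..<s])"
  have sq [measurable]: "(\<lambda>z. (norm (G x z - ?c))\<^sup>2) \<in> borel_measurable P"
    by measurable
  have real_s: "3 * \<sigma>\<^sup>2 / e\<^sup>2 \<le> real s"
    unfolding s_def by (rule real_nat_ceiling_ge)
  moreover have "0 < 3 * \<sigma>\<^sup>2 / e\<^sup>2"
    using \<open>0 < \<sigma>\<close> \<open>0 < e\<close> by simp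
  ultimately have s: "0 < s"
    by linarith
  have coords: "Z.indep_vars (\<lambda>_. P) (\<lambda>n zs. zs n) UNIV"
    unfolding Z_def by (intro indep_vars_PiM_components P.prob_space_axioms) simp
  have G_indep: "Z.indep_vars (\<lambda>_. borel) (\<lambda>n zs. G x (zs n)) UNIV"
    by (intro Z.indep_vars_compose2[OF coords] G)
  have comp: "distr Z P (\<lambda>zs. zs n) = P" for n
    unfolding Z_def by (rule distr_PiM_component) (simp_all add: P.prob_space_axioms)
  have comp_meas [measurable]: "(\<lambda>zs. zs n) \<in> Z \<rightarrow>\<^sub>M P" for n
    unfolding Z_def by measurable
  have transfer: "integrable Z (\<lambda>zs. F (zs n)) \<longleftrightarrow> integrable P F"
    "(\<integral>zs. F (zs n) \<partial>Z) = (\<integral>z. F z \<partial>P)"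
    if "F \<in> borel_measurable P" for F :: "_ \<Rightarrow> 'e::{banach, second_countable_topology}" and n
    using that integrable_distr_eq[OF comp_meas[of n], of F] integral_distr[OF comp_meas[of n], of F]
    by (simp_all add: comp)
  have "Z.indep_vars (\<lambda>k. PiM (?K k) (\<lambda>_. P)) (\<lambda>k zs. \<lambda>i\<in>?K k. zs i) {..<m}"
  proof (rule Z.indep_vars_restrict[OF coords])
    have disj: "?K k \<inter> ?K l = {}" if "k < l" for k l
    proof -
      have "(k + 1) * s \<le> l * s"
        using that by (intro mult_right_mono) auto
      then show ?thesis
        by auto
    qed
    then show "disjoint_family_on ?K {..<m}"
      unfolding disjoint_family_on_def by (metis inf_commute nat_neq_iff)
  qed simp
  then have "Z.indep_vars (\<lambda>_. borel) (\<lambda>k zs. ?v k (\<lambda>i\<in>?K k. zs i)) {..<m}"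
  proof (rule Z.indep_vars_compose2)
    fix k
    show "?v k \<in> borel_measurable (PiM (?K k) (\<lambda>_. P))"
      unfolding average_map_upt
      by (intro borel_measurable_scaleR borel_measurable_sum borel_measurable_const
          measurable_compose[OF _ G] measurable_component_singleton) auto
  qed
  moreover have "?v k (\<lambda>i\<in>?K k. zs i) = ?v k zs" for k zs
    by (intro arg_cong[where f=average] map_cong) auto
  ultimately have "Z.indep_vars (\<lambda>_. borel) ?v {..<m}"
    by simp
  moreover have "Z.prob {zs \<in> space Z. ?v k zs \<in> cball ?c e} \<ge> 2 / 3" for k
  proof -
    have "Z.prob {zs \<in> space Z.
        norm ((1 / real (card (?K k))) *\<^sub>R (\<Sum>i\<in>?K k. G x (zs i)) - ?c) \<le> e} \<ge> 2 / 3"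
    proof (rule Z.mean_deviation[where V="\<sigma>\<^sup>2"])
      show "Z.indep_vars (\<lambda>_. borel) (\<lambda>n zs. G x (zs n)) (?K k)"
        by (rule Z.indep_vars_subset[OF G_indep]) simp
    qed (use grad s real_s \<open>0 < e\<close> in \<open>auto simp: transfer[OF G] transfer[OF sq] stochastic_gradient_oracle_def\<close>)
    then show ?thesis
      by (simp add: average_block[where F="\<lambda>n. G x (_ n)"] dist_norm norm_minus_commute)
  qed
  ultimately have "Z.prob {zs \<in> space Z. m < 2 * card {k. k < m \<and> ?v k zs \<in> cball ?c e}}
      \<ge> 1 - exp (- real m / 18)"
    by (intro Z.majority_prob) auto
  then show ?thesis
    by (simp add: dist_norm norm_minus_commute)
qed

section \<open>Measurability\<close>

lemma sets_Collect_card: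
  fixes m :: nat and Q :: "'a \<Rightarrow> nat \<Rightarrow> bool"
  assumes Q: "\<And>k. k < m \<Longrightarrow> {\<omega> \<in> space M. Q \<omega> k} \<in> sets M"
  shows "{\<omega> \<in> space M. R (card {k. k < m \<and> Q \<omega> k})} \<in> sets M"
proof -
  have "{\<omega> \<in> space M. k \<in> {k. k < m \<and> Q \<omega> k}} \<in> sets M" for k
    using Q[of k] by (cases "k < m") auto
  then have "(\<lambda>\<omega>. card {k. k < m \<and> Q \<omega> k}) \<in> M \<rightarrow>\<^sub>M count_space UNIV"
    by (rule measurable_card)
  then have "(\<lambda>\<omega>. card {k. k < m \<and> Q \<omega> k}) -` {n. R n} \<inter> space M \<in> sets M"
    by (rule measurable_sets) simp
  also have "(\<lambda>\<omega>. card {k. k < m \<and> Q \<omega> k}) -` {n. R n} \<inter> space M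
      = {\<omega> \<in> space M. R (card {k. k < m \<and> Q \<omega> k})}"
    by blast
  finally show ?thesis .
qed

lemma borel_measurable_radius:
  assumes "0 < m"
    and \<rho>: "\<And>k. k < m \<Longrightarrow> (\<lambda>\<omega>. \<rho> \<omega> (y \<omega> i) (y \<omega> k)) \<in> borel_measurable M"
  shows "(\<lambda>\<omega>. radius m (\<rho> \<omega>) (y \<omega>) i) \<in> borel_measurable M"
  unfolding borel_measurable_iff_Iic_ereal
proof
  fix r
  have "(\<lambda>\<omega>. radius m (\<rho> \<omega>) (y \<omega>) i) -` {..r} \<inter> space M
      = {\<omega> \<in> space M. 0 \<le> r \<and> m < 2 * card {k. k < m \<and> \<rho> \<omega> (y \<omega> i) (y \<omega> k) \<le> r}}"
    using radius_le_iff[OF \<open>0 < m\<close>] by auto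
  also have "\<dots> \<in> sets M"
    using \<rho> by (intro sets_Collect_card[where R="\<lambda>n. 0 \<le> r \<and> m < 2 * n"]) simp
  finally show "(\<lambda>\<omega>. radius m (\<rho> \<omega>) (y \<omega>) i) -` {..r} \<inter> space M \<in> sets M" .
qed

lemma borel_measurable_median_radius:
  assumes "0 < m"
    and \<rho>: "\<And>i k. i < m \<Longrightarrow> k < m \<Longrightarrow> (\<lambda>\<omega>. \<rho> \<omega> (y \<omega> i) (y \<omega> k)) \<in> borel_measurable M"
  shows "(\<lambda>\<omega>. median_radius m (\<rho> \<omega>) (y \<omega>)) \<in> borel_measurable M"
  unfolding borel_measurable_iff_Iic_ereal
proof
  fix r
  have "(\<lambda>\<omega>. median_radius m (\<rho> \<omega>) (y \<omega>)) -` {..r} \<inter> space M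
      = {\<omega> \<in> space M. m \<le> 2 * card {i. i < m \<and> radius m (\<rho> \<omega>) (y \<omega>) i \<le> r}}"
    using median_radius_le_iff[OF \<open>0 < m\<close>] by auto
  also have "\<dots> \<in> sets M"
    using borel_measurable_radius[where \<rho>=\<rho> and y=y, OF assms]
    by (intro sets_Collect_card[where R="\<lambda>n. m \<le> 2 * n"]) simp
  finally show "(\<lambda>\<omega>. median_radius m (\<rho> \<omega>) (y \<omega>)) -` {..r} \<inter> space M \<in> sets M" .
qed

lemma measurable_extract_indices:
  assumes "0 < m"
    and \<rho>: "\<And>i k. i < m \<Longrightarrow> k < m \<Longrightarrow> (\<lambda>\<omega>. \<rho> \<omega> (y \<omega> i) (y \<omega> k)) \<in> borel_measurable M"
  shows "Measurable.pred M (\<lambda>\<omega>. i \<in> extract_indices m (\<rho> \<omega>) (y \<omega>))"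
proof (cases "i < m")
  case True
  note [measurable] = borel_measurable_radius[where \<rho>=\<rho> and y=y, OF assms(1) \<rho>[OF True]]
    borel_measurable_median_radius[where \<rho>=\<rho> and y=y, OF assms]
  show ?thesis
    unfolding extract_indices_def using True by simp
qed (simp add: extract_indices_def)

lemma measurable_points_component [measurable]:
  "(\<lambda>x::nat \<Rightarrow> 'a::euclidean_space. x i) \<in> points m \<rightarrow>\<^sub>M borel"
proof (cases "i < m")
  case False
  then have "x i = undefined" if "x \<in> space (points m)" for x :: "nat \<Rightarrow> 'a"
    using that by (auto simp: space_PiM PiE_def extensional_def)
  then have "(\<lambda>x::nat \<Rightarrow> 'a. x i) \<in> points m \<rightarrow>\<^sub>M borel
      \<longleftrightarrow> (\<lambda>x::nat \<Rightarrow> 'a. undefined :: 'a) \<in> points m \<rightarrow>\<^sub>M borel"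
    by (rule measurable_cong)
  then show ?thesis
    by simp
qed simp

lemma measurable_points_apply:
  assumes x [measurable]: "x \<in> M \<rightarrow>\<^sub>M points m" and c: "c \<in> M \<rightarrow>\<^sub>M count_space UNIV"
  shows "(\<lambda>\<omega>. x \<omega> (c \<omega>)) \<in> borel_measurable M"
  by (rule measurable_compose_countable[OF _ c]) (rule measurable_compose[OF x measurable_points_component])

lemma measure_pair_ge_sections:
  assumes "prob_space M" "prob_space N" and B: "B \<in> sets (M \<Otimes>\<^sub>M N)"
    and c: "\<And>x. x \<in> space M \<Longrightarrow> c \<le> measure N (Pair x -` B)"
  shows "c \<le> measure (M \<Otimes>\<^sub>M N) B"
proof -
  interpret M: prob_space M by fact
  interpret N: prob_space N by fact
  interpret MN: pair_prob_space M N ..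
  have "ennreal c = (\<integral>\<^sup>+x. ennreal c \<partial>M)"
    by (simp add: M.emeasure_space_1)
  also have "\<dots> \<le> (\<integral>\<^sup>+x. emeasure N (Pair x -` B) \<partial>M)"
    using c by (intro nn_integral_mono) (simp add: N.emeasure_eq_measure ennreal_leI)
  also have "\<dots> = emeasure (M \<Otimes>\<^sub>M N) B"
    by (rule N.emeasure_pair_measure_alt[OF B, symmetric])
  finally show ?thesis
    by (simp add: MN.emeasure_eq_measure)
qed

section \<open>The guarantee in probability\<close>

locale robust_gap_execution = composite_minimizer g h L \<mu> xbar
  for g :: "'a::euclidean_space \<Rightarrow> real" and h :: "'a \<Rightarrow> ereal" and L \<mu> :: real and xbar :: 'a +
  fixes \<sigma> \<epsilon> :: real and m :: nat
    and P :: "'z measure" and G :: "'a \<Rightarrow> 'z \<Rightarrow> 'a"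
    and U :: "'u measure" and A :: "real \<Rightarrow> 'u \<Rightarrow> 'a"
    and sel1 :: "(nat \<Rightarrow> 'a) \<Rightarrow> nat" and tie :: "'a \<Rightarrow> (nat \<Rightarrow> 'a) \<Rightarrow> nat"
    and sel2 :: "(nat \<Rightarrow> 'a) \<Rightarrow> 'a \<Rightarrow> nat"
  assumes \<sigma>_pos: "0 < \<sigma>" and \<epsilon>_pos: "0 < \<epsilon>" and m_pos: "0 < m"
    and grad_oracle: "stochastic_gradient_oracle g \<sigma> P G"
    and min_oracle: "minimization_oracle (\<lambda>x. ereal (g x) + h x) U A"
    and rules: "selection_rules h m sel1 tie sel2"
begin

definition accuracy :: real where
  "accuracy = L / \<mu> * sqrt (\<mu> * \<epsilon>)"

definition batch :: nat where
  "batch = nat \<lceil>3 * \<sigma>\<^sup>2 / accuracy\<^sup>2\<rceil>"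

definition candidates :: "(nat \<Rightarrow> 'u) \<Rightarrow> nat \<Rightarrow> 'a" where
  "candidates us = (\<lambda>i\<in>{..<m}. A \<epsilon> (us i))"

definition centre :: "(nat \<Rightarrow> 'u) \<Rightarrow> 'a" where
  "centre us = candidates us (sel1 (candidates us))"

definition estimates :: "(nat \<Rightarrow> 'u) \<Rightarrow> (nat \<Rightarrow> 'z) \<Rightarrow> nat \<Rightarrow> 'a" where
  "estimates us zs =
     (\<lambda>k\<in>{..<m}. average (map (\<lambda>j. G (centre us) (zs (k * batch + j))) [0..<batch]))"

definition slope :: "(nat \<Rightarrow> 'u) \<Rightarrow> (nat \<Rightarrow> 'z) \<Rightarrow> 'a" where
  "slope us zs = estimates us zs (tie (centre us) (estimates us zs))"

definition common :: "(nat \<Rightarrow> 'u) \<Rightarrow> (nat \<Rightarrow> 'z) \<Rightarrow> nat set" where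
  "common us zs = extract_indices m rho1 (candidates us)
     \<inter> extract_indices m (rho2 h (slope us zs)) (candidates us)"

definition selected :: "(nat \<Rightarrow> 'u) \<Rightarrow> (nat \<Rightarrow> 'z) \<Rightarrow> 'a" where
  "selected us zs = candidates us (sel2 (candidates us) (slope us zs))"

definition accurate :: "'a \<Rightarrow> bool" where
  "accurate x \<longleftrightarrow> norm (x - xbar) \<le> 3 * sqrt (2 * \<epsilon> / \<mu>) \<and>
     D_h g h x xbar \<le> ereal (65 * (L / \<mu>) * \<epsilon>) \<and>
     f x - (INF y. f y) \<le> ereal (74 * (L / \<mu>) * \<epsilon>)"

lemma result_of_run:
  "result_of (run A G (robust_gap sel1 tie sel2 h (L / \<mu>) \<mu> \<sigma> m \<epsilon>) us zs)
     = (if common us zs = {} then None else Some (selected us zs))"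
  unfolding run_robust_gap result_of_def common_def selected_def slope_def estimates_def
    centre_def candidates_def batch_def accuracy_def
  by simp

lemma accuracy_pos: "0 < accuracy"
  using L_pos \<mu>_pos \<epsilon>_pos by (simp add: accuracy_def)

interpretation P: prob_space P
  using grad_oracle by (simp add: stochastic_gradient_oracle_def)

interpretation U: prob_space U
  using min_oracle by (simp add: minimization_oracle_def)

abbreviation seeds :: "(nat \<Rightarrow> 'u) measure" where "seeds \<equiv> \<Pi>\<^sub>M n\<in>UNIV. U"
abbreviation samples :: "(nat \<Rightarrow> 'z) measure" where "samples \<equiv> \<Pi>\<^sub>M n\<in>UNIV. P"

interpretation seeds: prob_space seeds
  by (intro prob_space_PiM U.prob_space_axioms)

interpretation samples: prob_space samples
  by (intro prob_space_PiM P.prob_space_axioms)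

interpretation T: pair_prob_space seeds samples ..

lemma h_measurable [measurable]: "h \<in> borel_measurable borel"
  by (rule borel_measurable_closed_convex_fun[OF closed_convex])

lemma g_measurable [measurable]: "g \<in> borel_measurable borel"
proof (rule borel_measurable_continuous_onI)
  show "continuous_on UNIV g"
    using smooth_fun_GDERIV[OF smooth] unfolding gderiv_def
    by (intro continuous_at_imp_continuous_on ballI has_derivative_continuous)
qed

lemma gradient_measurable [measurable]: "gradient g \<in> borel_measurable borel"
  using smooth by (intro borel_measurable_continuous_onI)
    (auto simp: smooth_fun_def intro: lipschitz_on_continuous_on)

lemma A_measurable [measurable]: "A \<epsilon> \<in> U \<rightarrow>\<^sub>M borel"
  using min_oracle \<epsilon>_pos by (simp add: minimization_oracle_def)

lemma candidates_measurable [measurable]: "candidates \<in> seeds \<rightarrow>\<^sub>M points m"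
  unfolding candidates_def by measurable

lemma sel1_measurable [measurable]: "sel1 \<in> points m \<rightarrow>\<^sub>M count_space UNIV"
  and tie_measurable: "(\<lambda>(xhat, v). tie xhat v) \<in> borel \<Otimes>\<^sub>M points m \<rightarrow>\<^sub>M count_space UNIV"
  and sel2_measurable: "(\<lambda>(x, w). sel2 x w) \<in> points m \<Otimes>\<^sub>M borel \<rightarrow>\<^sub>M count_space UNIV"
  using rules by (simp_all add: selection_rules_def selects_from_def)

lemma centre_measurable [measurable]: "centre \<in> borel_measurable seeds"
  unfolding centre_def by (intro measurable_points_apply) measurable

lemma estimates_measurable [measurable]:
  "(\<lambda>(us, zs). estimates us zs) \<in> seeds \<Otimes>\<^sub>M samples \<rightarrow>\<^sub>M points m"
proof -
  have joint: "(\<lambda>(x, z). G x z) \<in> borel_measurable (borel \<Otimes>\<^sub>M P)"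
    using grad_oracle by (simp add: stochastic_gradient_oracle_def)
  have [measurable]: "(\<lambda>\<omega>. G (centre (fst \<omega>)) (snd \<omega> n)) \<in> borel_measurable (seeds \<Otimes>\<^sub>M samples)" for n
    using measurable_compose[of "\<lambda>\<omega>. (centre (fst \<omega>), snd \<omega> n)", OF _ joint] by simp
  show ?thesis
    unfolding estimates_def average_map_upt case_prod_beta by measurable
qed

lemma slope_measurable [measurable]:
  "(\<lambda>(us, zs). slope us zs) \<in> borel_measurable (seeds \<Otimes>\<^sub>M samples)"
proof -
  have e: "(\<lambda>\<omega>. estimates (fst \<omega>) (snd \<omega>)) \<in> seeds \<Otimes>\<^sub>M samples \<rightarrow>\<^sub>M points m"
    using estimates_measurable by (simp add: case_prod_beta)
  have "(\<lambda>\<omega>. tie (centre (fst \<omega>)) (estimates (fst \<omega>) (snd \<omega>)))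
      \<in> seeds \<Otimes>\<^sub>M samples \<rightarrow>\<^sub>M count_space UNIV"
    using measurable_compose[of "\<lambda>\<omega>. (centre (fst \<omega>), estimates (fst \<omega>) (snd \<omega>))", OF _ tie_measurable] e
    by simp
  with e show ?thesis
    unfolding slope_def case_prod_beta by (rule measurable_points_apply)
qed

lemma selected_measurable [measurable]:
  "(\<lambda>(us, zs). selected us zs) \<in> borel_measurable (seeds \<Otimes>\<^sub>M samples)"
proof -
  have "(\<lambda>\<omega>. sel2 (candidates (fst \<omega>)) (slope (fst \<omega>) (snd \<omega>)))
      \<in> seeds \<Otimes>\<^sub>M samples \<rightarrow>\<^sub>M count_space UNIV"
    using measurable_compose[of "\<lambda>\<omega>. (candidates (fst \<omega>), slope (fst \<omega>) (snd \<omega>))", OF _ sel2_measurable]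
      slope_measurable
    by (simp add: case_prod_beta)
  then show ?thesis
    unfolding selected_def case_prod_beta by (intro measurable_points_apply) measurable
qed

lemma common_empty_measurable [measurable]:
  "Measurable.pred (seeds \<Otimes>\<^sub>M samples) (\<lambda>(us, zs). common us zs = {})"
proof -
  have c [measurable]: "(\<lambda>\<omega>. candidates (fst \<omega>) i) \<in> borel_measurable (seeds \<Otimes>\<^sub>M samples)" for i
    by (rule measurable_compose[OF _ measurable_points_component]) measurable
  have [measurable]: "(\<lambda>\<omega>. slope (fst \<omega>) (snd \<omega>)) \<in> borel_measurable (seeds \<Otimes>\<^sub>M samples)"
    using slope_measurable by (simp add: case_prod_beta)
  have [measurable]: "Measurable.pred (seeds \<Otimes>\<^sub>M samples)
      (\<lambda>\<omega>. i \<in> extract_indices m rho1 (candidates (fst \<omega>)))" for i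
    by (rule measurable_extract_indices[OF m_pos]) (simp add: rho1_def)
  have [measurable]: "Measurable.pred (seeds \<Otimes>\<^sub>M samples)
      (\<lambda>\<omega>. i \<in> extract_indices m (rho2 h (slope (fst \<omega>) (snd \<omega>))) (candidates (fst \<omega>)))" for i
    by (rule measurable_extract_indices[OF m_pos]) (simp add: rho2_def)
  show ?thesis
    unfolding common_def case_prod_beta disjoint_iff by measurable
qed

lemma accurate_measurable [measurable]: "Measurable.pred borel accurate"
  unfolding accurate_def[abs_def] D_h_def by measurable

definition good_candidates :: "((nat \<Rightarrow> 'u) \<times> (nat \<Rightarrow> 'z)) set" where
  "good_candidates = {\<omega> \<in> space (seeds \<Otimes>\<^sub>M samples).
     m < 2 * card {k. k < m \<and> f (candidates (fst \<omega>) k) - (INF y. f y) \<le> ereal \<epsilon>}}"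

definition good_estimates :: "((nat \<Rightarrow> 'u) \<times> (nat \<Rightarrow> 'z)) set" where
  "good_estimates = {\<omega> \<in> space (seeds \<Otimes>\<^sub>M samples).
     m < 2 * card {k. k < m \<and>
       norm (estimates (fst \<omega>) (snd \<omega>) k - gradient g (centre (fst \<omega>))) \<le> accuracy}}"

lemma good_candidates_sets: "good_candidates \<in> sets (seeds \<Otimes>\<^sub>M samples)"
proof -
  have [measurable]: "(\<lambda>\<omega>. candidates (fst \<omega>) i) \<in> borel_measurable (seeds \<Otimes>\<^sub>M samples)" for i
    by (rule measurable_compose[OF _ measurable_points_component]) measurable
  show ?thesis
    unfolding good_candidates_def
    by (intro sets_Collect_card[where R="\<lambda>n. m < 2 * n"]) measurable
qed

lemma good_estimates_sets: "good_estimates \<in> sets (seeds \<Otimes>\<^sub>M samples)"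
proof -
  have [measurable]: "(\<lambda>\<omega>. estimates (fst \<omega>) (snd \<omega>) k) \<in> borel_measurable (seeds \<Otimes>\<^sub>M samples)" for k
    using measurable_compose[OF estimates_measurable measurable_points_component]
    by (simp add: case_prod_beta)
  show ?thesis
    unfolding good_estimates_def
    by (intro sets_Collect_card[where R="\<lambda>n. m < 2 * n"]) measurable
qed

lemma prob_good_candidates:
  "measure (seeds \<Otimes>\<^sub>M samples) good_candidates \<ge> 1 - exp (- real m / 18)"
proof -
  let ?S = "{u \<in> space U. f (A \<epsilon> u) - (INF y. f y) \<le> ereal \<epsilon>}"
  let ?C = "{us \<in> space seeds. m < 2 * card {k. k < m \<and> us k \<in> ?S}}"
  have S: "?S \<in> sets U"
    by measurable
  have C: "1 - exp (- real m / 18) \<le> measure seeds ?C"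
  proof (rule seeds.majority_prob[OF _ S])
    show "seeds.indep_vars (\<lambda>_. U) (\<lambda>k us. us k) {..<m}"
      by (rule seeds.indep_vars_subset[OF indep_vars_PiM_components]) (auto intro: U.prob_space_axioms)
    fix k
    have "{us \<in> space seeds. us k \<in> ?S} = (\<lambda>us. us k) -` ?S \<inter> space seeds"
      by auto
    also have "measure seeds \<dots> = measure (distr seeds U (\<lambda>us. us k)) ?S"
      using S by (intro measure_distr[symmetric]) measurable
    also have "distr seeds U (\<lambda>us. us k) = U"
      by (rule distr_PiM_component) (auto intro: U.prob_space_axioms)
    finally show "measure seeds {us \<in> space seeds. us k \<in> ?S} \<ge> 2 / 3"
      using min_oracle \<epsilon>_pos by (simp add: minimization_oracle_def)
  qed
  have "?C \<times> space samples = good_candidates"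
  proof -
    have "{k. k < m \<and> us k \<in> ?S} = {k. k < m \<and> f (candidates us k) - (INF y. f y) \<le> ereal \<epsilon>}"
      if "us \<in> space seeds" for us
      using that by (auto simp: candidates_def space_PiM PiE_iff)
    then show ?thesis
      by (auto simp: good_candidates_def space_pair_measure)
  qed
  moreover have "measure (seeds \<Otimes>\<^sub>M samples) (?C \<times> space samples) = measure seeds ?C"
  proof -
    have "?C \<in> sets seeds"
      using S by (intro sets_Collect_card[where R="\<lambda>n. m < 2 * n"]) measurable
    then show ?thesis
      by (simp add: measure_def samples.emeasure_pair_measure_Times samples.emeasure_space_1)
  qed
  ultimately show ?thesis
    using C by simp
qed

lemma prob_good_estimates:
  "measure (seeds \<Otimes>\<^sub>M samples) good_estimates \<ge> 1 - exp (- real m / 18)"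
proof (rule measure_pair_ge_sections)
  fix us assume us: "us \<in> space seeds"
  have "Pair us -` good_estimates = {zs \<in> space samples. m < 2 * card {k. k < m \<and>
      norm (average (map (\<lambda>j. G (centre us) (zs (k * batch + j))) [0..<batch])
        - gradient g (centre us)) \<le> accuracy}}"
    using us
    by (auto simp: good_estimates_def space_pair_measure estimates_def cong: conj_cong)
  then show "1 - exp (- real m / 18) \<le> measure samples (Pair us -` good_estimates)"
    using estimator_majority[OF grad_oracle \<sigma>_pos accuracy_pos, folded batch_def] by simp
qed (rule seeds.prob_space_axioms samples.prob_space_axioms good_estimates_sets)+

lemma accurate_selected:
  assumes "(us, zs) \<in> good_candidates" "(us, zs) \<in> good_estimates" "common us zs \<noteq> {}"
  shows "accurate (selected us zs)"
proof -
  let ?x = "candidates us"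
  let ?S = "{k. k < m \<and> f (?x k) - (INF y. f y) \<le> ereal \<epsilon>}"
  let ?E = "{k. k < m \<and> norm (estimates us zs k - gradient g (centre us)) \<le> accuracy}"
  have x: "?x \<in> space (points m)"
    by (auto simp: candidates_def space_PiM)
  have v: "estimates us zs \<in> space (points m)"
    by (auto simp: estimates_def space_PiM)
  have S: "?S \<subseteq> {..<m}" "m < 2 * card ?S"
    using assms(1) by (auto simp: good_candidates_def)
  have gap: "f (?x k) - (INF y. f y) \<le> ereal \<epsilon>" if "k \<in> ?S" for k
    using that by simp
  have sel1: "sel1 ?x \<in> extract_indices m rho1 ?x"
    using rules x extract_nonempty[OF m_pos, of rho1 ?x]
    by (auto simp: selection_rules_def selects_from_def)
  have "tie (centre us) (estimates us zs) \<in> minimal_radius m (estimates us zs)"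
    using rules v minimal_radius_nonempty[OF m_pos, of "estimates us zs"]
    by (auto simp: selection_rules_def selects_from_def space_pair_measure)
  then have "norm (slope us zs - gradient g (centre us)) \<le> 3 * accuracy"
    unfolding slope_def
    by (rule minimal_radius_near_majority[where S="?E"]) (use assms(2) in \<open>auto simp: good_estimates_def\<close>)
  then have w: "norm (slope us zs - gradient g (?x (sel1 ?x))) \<le> 3 * (L / \<mu> * sqrt (\<mu> * \<epsilon>))"
    by (simp only: centre_def accuracy_def)
  have "sel2 ?x (slope us zs) \<in> common us zs"
    using rules x assms(3)
    by (auto simp: selection_rules_def selects_from_def space_pair_measure common_def)
  then have "sel2 ?x (slope us zs) \<in> extract_indices m rho1 ?x"
    "sel2 ?x (slope us zs) \<in> extract_indices m (rho2 h (slope us zs)) ?x"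
    by (simp_all add: common_def)
  from robust_gap_guarantee[where x="?x", OF \<epsilon>_pos S gap sel1 w this] show ?thesis
    unfolding accurate_def selected_def by blast
qed

lemma prob_accurate:
  "measure (seeds \<Otimes>\<^sub>M samples)
     {(us, zs) \<in> space (seeds \<Otimes>\<^sub>M samples). common us zs \<noteq> {} \<longrightarrow> accurate (selected us zs)}
   \<ge> 1 - 2 * exp (- real m / 18)"
proof -
  let ?\<Omega> = "space (seeds \<Otimes>\<^sub>M samples)"
  let ?E = "{(us, zs) \<in> ?\<Omega>. common us zs \<noteq> {} \<longrightarrow> accurate (selected us zs)}"
  have "?E = {\<omega> \<in> ?\<Omega>. (case \<omega> of (us, zs) \<Rightarrow> common us zs = {}) \<or> accurate (case \<omega> of (us, zs) \<Rightarrow> selected us zs)}"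
    by auto
  also have "\<dots> \<in> sets (seeds \<Otimes>\<^sub>M samples)"
    by measurable
  finally have E: "?E \<in> sets (seeds \<Otimes>\<^sub>M samples)" .
  have "T.prob (?\<Omega> - ?E) \<le> T.prob ((?\<Omega> - good_candidates) \<union> (?\<Omega> - good_estimates))"
    using good_candidates_sets good_estimates_sets accurate_selected
    by (intro T.finite_measure_mono) auto
  also have "\<dots> \<le> T.prob (?\<Omega> - good_candidates) + T.prob (?\<Omega> - good_estimates)"
    using good_candidates_sets good_estimates_sets by (intro measure_Un_le) auto
  finally show ?thesis
    using prob_good_candidates prob_good_estimates
    by (simp add: T.prob_compl good_candidates_sets good_estimates_sets E)
qed

end

theorem theorem6p5:
  fixes g :: "'a::euclidean_space \<Rightarrow> real" and h f :: "'a \<Rightarrow> ereal"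
    and L \<mu> \<kappa> \<sigma> \<epsilon> :: real and xbar :: 'a and m :: nat
    and P :: "'z measure" and G :: "'a \<Rightarrow> 'z \<Rightarrow> 'a"
    and U :: "'u measure" and A :: "real \<Rightarrow> 'u \<Rightarrow> 'a"
    and sel1 :: "(nat \<Rightarrow> 'a) \<Rightarrow> nat" and tie :: "'a \<Rightarrow> (nat \<Rightarrow> 'a) \<Rightarrow> nat"
    and sel2 :: "(nat \<Rightarrow> 'a) \<Rightarrow> 'a \<Rightarrow> nat"
  assumes "\<mu> > 0" and "\<sigma> > 0" and "\<epsilon> > 0" and "\<kappa> = L / \<mu>"
    and "smooth_fun L g" and "strongly_convex \<mu> g" and "closed_convex_fun h"
    and "f = (\<lambda>x. ereal (g x) + h x)"
    and "is_arg_min f (\<lambda>_. True) xbar"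
    and "stochastic_gradient_oracle g \<sigma> P G"
    and "minimization_oracle f U A"
    and "selection_rules h m sel1 tie sel2"
  shows "let exec = (\<lambda>us zs. run A G (robust_gap sel1 tie sel2 h \<kappa> \<mu> \<sigma> m \<epsilon>) us zs) in
      measure (tapes U P) {(us, zs) \<in> space (tapes U P).
         \<forall>x. result_of (exec us zs) = Some x \<longrightarrow>
           norm (x - xbar) \<le> 3 * sqrt (2 * \<epsilon> / \<mu>) \<and>
           D_h g h x xbar \<le> ereal (65 * \<kappa> * \<epsilon>) \<and>
           f x - (INF y. f y) \<le> ereal (74 * \<kappa> * \<epsilon>)} \<ge> 1 - 2 * exp (- real m / 18) \<and>
      (\<forall>(us, zs) \<in> space (tapes U P).
         (odd m \<longrightarrow> result_of (exec us zs) \<noteq> None) \<and>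
         min_queries (exec us zs) = replicate m \<epsilon> \<and>
         (let x = (\<lambda>i\<in>{..<m}. A \<epsilon> (us i)) in
            grad_queries (exec us zs) =
              replicate (m * nat \<lceil>3 * \<sigma>\<^sup>2 / (\<kappa>\<^sup>2 * \<mu> * \<epsilon>)\<rceil>) (x (sel1 x))))"
proof -
  let ?exec = "run A G (robust_gap sel1 tie sel2 h \<kappa> \<mu> \<sigma> m \<epsilon>)"
  let ?E = "{(us, zs) \<in> space (tapes U P).
         \<forall>x. result_of (?exec us zs) = Some x \<longrightarrow>
           norm (x - xbar) \<le> 3 * sqrt (2 * \<epsilon> / \<mu>) \<and>
           D_h g h x xbar \<le> ereal (65 * \<kappa> * \<epsilon>) \<and>
           f x - (INF y. f y) \<le> ereal (74 * \<kappa> * \<epsilon>)}"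
  have "measure (tapes U P) ?E \<ge> 1 - 2 * exp (- real m / 18)"
  proof (cases "m = 0")
    case True
    then show ?thesis
      by (simp add: order_trans[OF _ measure_nonneg])
  next
    case False
    interpret robust_gap_execution g h L \<mu> xbar \<sigma> \<epsilon> m P G U A sel1 tie sel2
      using assms False by unfold_locales (auto simp: is_arg_min_linorder)
    have "?E = {(us, zs) \<in> space (tapes U P). common us zs \<noteq> {} \<longrightarrow> accurate (selected us zs)}"
      unfolding assms(4) result_of_run accurate_def assms(8) by auto
    then show ?thesis
      using prob_accurate by (simp add: tapes_def)
  qed
  moreover have "result_of (?exec us zs) \<noteq> None" if "odd m" for us zs
    by (simp add: run_robust_gap result_of_def extract_Int_nonempty[OF that] del: restrict_apply)
  moreover have "(\<kappa> * sqrt (\<mu> * \<epsilon>))\<^sup>2 = \<kappa>\<^sup>2 * \<mu> * \<epsilon>"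
    using assms(1,3) by (simp add: power_mult_distrib)
  then have "min_queries (?exec us zs) = replicate m \<epsilon>"
    "grad_queries (?exec us zs) = replicate (m * nat \<lceil>3 * \<sigma>\<^sup>2 / (\<kappa>\<^sup>2 * \<mu> * \<epsilon>)\<rceil>)
       ((\<lambda>i\<in>{..<m}. A \<epsilon> (us i)) (sel1 (\<lambda>i\<in>{..<m}. A \<epsilon> (us i))))" for us zs
    by (simp_all add: run_robust_gap min_queries_def grad_queries_def del: restrict_apply)
  ultimately show ?thesis
    unfolding Let_def by auto
qed

end
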